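(* Let $\mathsf A$ be an abelian category and $\mathsf C\subset\mathsf A$ be a full subcategory closed under finite direct sums of objects and the kernels and cokernels of morphisms. Let $m\ge0$ be an integer. Then the full subcategory $\mathsf C^{(m)}_{\mathsf A}\subset\mathsf A$ is also closed under finite direct sums, kernels, and cokernels. So, from any two abelian categories $\mathsf C$ and $\mathsf A$ with a fully faithful exact functor $\mathsf C\to\mathsf A$ one can produce in this way a sequence of abelian categories $\mathsf C^{(m)}_{\mathsf A}$ with fully faithful exact functors $\mathsf C^{(m)}_{\mathsf A}\to\mathsf A$.
   Context: For a full subcategory $\mathsf C$ (containing the zero object) of an abelian category $\mathsf A$ and an integer $m\ge0$, $\mathsf C^{(m)}_{\mathsf A}\subset\mathsf A$ denotes the full subcategory of all objects $X\in\mathsf A$ admitting a filtration by subobjects $0=X_0\subset X_1\subset\dots\subset X_{m-1}\subset X_m=X$ such that $X_j/X_{j-1}\in\mathsf C$ for all $1\le j\le m$. In particular $\mathsf C^{(0)}_{\mathsf A}=\{0\}$ and $\mathsf C^{(1)}_{\mathsf A}=\mathsf C$. Kernels, cokernels and direct sums are computed in $\mathsf A$; full subcategories are understood to be closed under isomorphism. For a fully faithful exact functor $\mathsf C\to\mathsf A$, $\mathsf C$ is identified with its essential image. *)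

theory Defs
  imports "HOL-Algebra.Group"
begin

section \<open>Preadditive categories\<close>

text \<open>Composition is in applicative order: \<open>Comp A g f\<close> is ``first \<open>f\<close>, then \<open>g\<close>''.
  \<open>Add\<close> and \<open>Zero\<close> are the addition of parallel morphisms and the zero morphisms.\<close>

record ('o, 'm) precat =
  Obj :: "'o set"
  Arr :: "'m set"
  Dom :: "'m \<Rightarrow> 'o"
  Cod :: "'m \<Rightarrow> 'o"
  Ide :: "'o \<Rightarrow> 'm"
  Comp :: "'m \<Rightarrow> 'm \<Rightarrow> 'm"
  Add :: "'m \<Rightarrow> 'm \<Rightarrow> 'm"
  Zero :: "'o \<Rightarrow> 'o \<Rightarrow> 'm"

definition Hom :: "('o, 'm) precat \<Rightarrow> 'o \<Rightarrow> 'o \<Rightarrow> 'm set" where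
  "Hom A X Y = {f \<in> Arr A. Dom A f = X \<and> Cod A f = Y}"

definition hom_group :: "('o, 'm) precat \<Rightarrow> 'o \<Rightarrow> 'o \<Rightarrow> 'm monoid" where
  "hom_group A X Y = \<lparr>carrier = Hom A X Y, mult = Add A, one = Zero A X Y\<rparr>"

locale category =
  fixes A :: "('o, 'm) precat"
  assumes dom_in_Obj: "f \<in> Arr A \<Longrightarrow> Dom A f \<in> Obj A"
    and cod_in_Obj: "f \<in> Arr A \<Longrightarrow> Cod A f \<in> Obj A"
    and ide_in_Hom: "X \<in> Obj A \<Longrightarrow> Ide A X \<in> Hom A X X"
    and comp_in_Hom: "\<lbrakk>f \<in> Hom A X Y; g \<in> Hom A Y Z\<rbrakk> \<Longrightarrow> Comp A g f \<in> Hom A X Z"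
    and comp_assoc: "\<lbrakk>f \<in> Hom A W X; g \<in> Hom A X Y; h \<in> Hom A Y Z\<rbrakk>
          \<Longrightarrow> Comp A h (Comp A g f) = Comp A (Comp A h g) f"
    and comp_ide_left: "f \<in> Hom A X Y \<Longrightarrow> Comp A (Ide A Y) f = f"
    and comp_ide_right: "f \<in> Hom A X Y \<Longrightarrow> Comp A f (Ide A X) = f"

locale preadditive_category = category A
  for A :: "('o, 'm) precat" +
  assumes hom_comm_group: "\<lbrakk>X \<in> Obj A; Y \<in> Obj A\<rbrakk> \<Longrightarrow> comm_group (hom_group A X Y)"
    and comp_add_left: "\<lbrakk>f \<in> Hom A X Y; g \<in> Hom A Y Z; h \<in> Hom A Y Z\<rbrakk>
          \<Longrightarrow> Comp A (Add A g h) f = Add A (Comp A g f) (Comp A h f)"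
    and comp_add_right: "\<lbrakk>f \<in> Hom A X Y; g \<in> Hom A X Y; h \<in> Hom A Y Z\<rbrakk>
          \<Longrightarrow> Comp A h (Add A f g) = Add A (Comp A h f) (Comp A h g)"

section \<open>Monomorphisms, kernels, direct sums\<close>

definition monic :: "('o, 'm) precat \<Rightarrow> 'm \<Rightarrow> bool" where
  "monic A f \<longleftrightarrow> f \<in> Arr A \<and>
     (\<forall>Z. \<forall>g \<in> Hom A Z (Dom A f). \<forall>h \<in> Hom A Z (Dom A f).
        Comp A f g = Comp A f h \<longrightarrow> g = h)"

definition epic :: "('o, 'm) precat \<Rightarrow> 'm \<Rightarrow> bool" where
  "epic A f \<longleftrightarrow> f \<in> Arr A \<and>
     (\<forall>Z. \<forall>g \<in> Hom A (Cod A f) Z. \<forall>h \<in> Hom A (Cod A f) Z.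
        Comp A g f = Comp A h f \<longrightarrow> g = h)"

definition iso_arr :: "('o, 'm) precat \<Rightarrow> 'm \<Rightarrow> bool" where
  "iso_arr A f \<longleftrightarrow> f \<in> Arr A \<and>
     (\<exists>g \<in> Hom A (Cod A f) (Dom A f).
        Comp A g f = Ide A (Dom A f) \<and> Comp A f g = Ide A (Cod A f))"

definition isomorphic :: "('o, 'm) precat \<Rightarrow> 'o \<Rightarrow> 'o \<Rightarrow> bool" where
  "isomorphic A X Y \<longleftrightarrow> (\<exists>f \<in> Hom A X Y. iso_arr A f)"

definition zero_object :: "('o, 'm) precat \<Rightarrow> 'o \<Rightarrow> bool" where
  "zero_object A Z \<longleftrightarrow> Z \<in> Obj A \<and>
     (\<forall>X \<in> Obj A. (\<exists>!f. f \<in> Hom A X Z) \<and> (\<exists>!f. f \<in> Hom A Z X))"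

text \<open>\<open>is_kernel A f k\<close>: the morphism \<open>k\<close> is a kernel of \<open>f\<close>; its object is \<open>Dom A k\<close>.
  Dually for \<open>is_cokernel A f q\<close>, with object \<open>Cod A q\<close>.\<close>

definition is_kernel :: "('o, 'm) precat \<Rightarrow> 'm \<Rightarrow> 'm \<Rightarrow> bool" where
  "is_kernel A f k \<longleftrightarrow> f \<in> Arr A \<and> k \<in> Arr A \<and> Cod A k = Dom A f \<and>
     Comp A f k = Zero A (Dom A k) (Cod A f) \<and>
     (\<forall>Z. \<forall>g \<in> Hom A Z (Dom A f). Comp A f g = Zero A Z (Cod A f) \<longrightarrow>
        (\<exists>!h. h \<in> Hom A Z (Dom A k) \<and> Comp A k h = g))"

definition is_cokernel :: "('o, 'm) precat \<Rightarrow> 'm \<Rightarrow> 'm \<Rightarrow> bool" where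
  "is_cokernel A f q \<longleftrightarrow> f \<in> Arr A \<and> q \<in> Arr A \<and> Dom A q = Cod A f \<and>
     Comp A q f = Zero A (Dom A f) (Cod A q) \<and>
     (\<forall>Z. \<forall>g \<in> Hom A (Cod A f) Z. Comp A g f = Zero A (Dom A f) Z \<longrightarrow>
        (\<exists>!h. h \<in> Hom A (Cod A q) Z \<and> Comp A h q = g))"

text \<open>\<open>X\<close> is the direct sum (coproduct) of \<open>Y 0, \<dots>, Y (n - 1)\<close> via the injections \<open>i k\<close>.
  For \<open>n = 0\<close> this says that \<open>X\<close> is initial, i.e. a zero object in a preadditive category.\<close>

definition is_direct_sum ::
  "('o, 'm) precat \<Rightarrow> nat \<Rightarrow> (nat \<Rightarrow> 'o) \<Rightarrow> 'o \<Rightarrow> (nat \<Rightarrow> 'm) \<Rightarrow> bool" where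
  "is_direct_sum A n Y X i \<longleftrightarrow> X \<in> Obj A \<and>
     (\<forall>k<n. Y k \<in> Obj A \<and> i k \<in> Hom A (Y k) X) \<and>
     (\<forall>Z \<in> Obj A. \<forall>g. (\<forall>k<n. g k \<in> Hom A (Y k) Z) \<longrightarrow>
        (\<exists>!h. h \<in> Hom A X Z \<and> (\<forall>k<n. Comp A h (i k) = g k)))"

section \<open>Abelian categories\<close>

locale abelian_category = preadditive_category A
  for A :: "('o, 'm) precat" +
  assumes has_zero_object: "\<exists>Z. zero_object A Z"
    and has_direct_sums: "(\<And>k. k < n \<Longrightarrow> Y k \<in> Obj A) \<Longrightarrow> \<exists>X i. is_direct_sum A n Y X i"
    and has_kernels: "f \<in> Arr A \<Longrightarrow> \<exists>k. is_kernel A f k"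
    and has_cokernels: "f \<in> Arr A \<Longrightarrow> \<exists>q. is_cokernel A f q"
    and monic_is_kernel: "monic A f \<Longrightarrow> \<exists>g. is_kernel A g f"
    and epic_is_cokernel: "epic A f \<Longrightarrow> \<exists>g. is_cokernel A g f"

definition short_exact :: "('o, 'm) precat \<Rightarrow> 'm \<Rightarrow> 'm \<Rightarrow> bool" where
  "short_exact A f g \<longleftrightarrow> is_kernel A g f \<and> is_cokernel A f g"

section \<open>Functors\<close>

locale additive_functor =
  B: preadditive_category B + A: preadditive_category A
  for B :: "('p, 'q) precat" and A :: "('o, 'm) precat" +
  fixes FO :: "'p \<Rightarrow> 'o" and FA :: "'q \<Rightarrow> 'm"
  assumes map_Obj: "X \<in> Obj B \<Longrightarrow> FO X \<in> Obj A"
    and map_Hom: "f \<in> Hom B X Y \<Longrightarrow> FA f \<in> Hom A (FO X) (FO Y)"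
    and map_ide: "X \<in> Obj B \<Longrightarrow> FA (Ide B X) = Ide A (FO X)"
    and map_comp: "\<lbrakk>f \<in> Hom B X Y; g \<in> Hom B Y Z\<rbrakk>
          \<Longrightarrow> FA (Comp B g f) = Comp A (FA g) (FA f)"
    and map_add: "\<lbrakk>f \<in> Hom B X Y; g \<in> Hom B X Y\<rbrakk>
          \<Longrightarrow> FA (Add B f g) = Add A (FA f) (FA g)"

locale exact_functor = additive_functor B A FO FA
  for B :: "('p, 'q) precat" and A :: "('o, 'm) precat" and FO FA +
  assumes map_short_exact: "short_exact B f g \<Longrightarrow> short_exact A (FA f) (FA g)"

definition fully_faithful ::
  "('p, 'q) precat \<Rightarrow> ('o, 'm) precat \<Rightarrow> ('p \<Rightarrow> 'o) \<Rightarrow> ('q \<Rightarrow> 'm) \<Rightarrow> bool" where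
  "fully_faithful B A FO FA \<longleftrightarrow>
     (\<forall>X \<in> Obj B. \<forall>Y \<in> Obj B. bij_betw FA (Hom B X Y) (Hom A (FO X) (FO Y)))"

definition ess_image ::
  "('p, 'q) precat \<Rightarrow> ('o, 'm) precat \<Rightarrow> ('p \<Rightarrow> 'o) \<Rightarrow> 'o set" where
  "ess_image B A FO = {X \<in> Obj A. \<exists>Y \<in> Obj B. isomorphic A (FO Y) X}"

section \<open>Full subcategories\<close>

text \<open>A full subcategory, closed under isomorphisms, is given by its set of objects.\<close>

definition replete :: "('o, 'm) precat \<Rightarrow> 'o set \<Rightarrow> bool" where
  "replete A C \<longleftrightarrow> C \<subseteq> Obj A \<and> (\<forall>X \<in> C. \<forall>Y. isomorphic A X Y \<longrightarrow> Y \<in> C)"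

definition full_subcat :: "('o, 'm) precat \<Rightarrow> 'o set \<Rightarrow> ('o, 'm) precat" where
  "full_subcat A C = A\<lparr>Obj := C, Arr := {f \<in> Arr A. Dom A f \<in> C \<and> Cod A f \<in> C}\<rparr>"

definition closed_direct_sums :: "('o, 'm) precat \<Rightarrow> 'o set \<Rightarrow> bool" where
  "closed_direct_sums A C \<longleftrightarrow>
     (\<forall>n Y X i. (\<forall>k<n. Y k \<in> C) \<and> is_direct_sum A n Y X i \<longrightarrow> X \<in> C)"

definition closed_kernels :: "('o, 'm) precat \<Rightarrow> 'o set \<Rightarrow> bool" where
  "closed_kernels A C \<longleftrightarrow>
     (\<forall>X \<in> C. \<forall>Y \<in> C. \<forall>f \<in> Hom A X Y. \<forall>k. is_kernel A f k \<longrightarrow> Dom A k \<in> C)"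

definition closed_cokernels :: "('o, 'm) precat \<Rightarrow> 'o set \<Rightarrow> bool" where
  "closed_cokernels A C \<longleftrightarrow>
     (\<forall>X \<in> C. \<forall>Y \<in> C. \<forall>f \<in> Hom A X Y. \<forall>q. is_cokernel A f q \<longrightarrow> Cod A q \<in> C)"

text \<open>The filtration \<open>0 = X\<^sub>0 \<subseteq> \<dots> \<subseteq> X\<^sub>m = X\<close>: the subobject \<open>X\<^sub>j\<close> is represented by
  the monomorphism \<open>s j\<close> into \<open>X\<close>, the inclusion \<open>X\<^sub>j \<subseteq> X\<^sub>j\<^sub>+\<^sub>1\<close> by \<open>t j\<close>, and
  the quotient \<open>X\<^sub>j\<^sub>+\<^sub>1 / X\<^sub>j\<close> by the cokernel \<open>q j\<close> of \<open>t j\<close>. Equality of subobjects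
  is up to isomorphism, so \<open>X\<^sub>m = X\<close> means that \<open>s m\<close> is invertible.\<close>

definition filtered :: "('o, 'm) precat \<Rightarrow> 'o set \<Rightarrow> nat \<Rightarrow> 'o set" where
  "filtered A C m = {X \<in> Obj A. \<exists>s t q.
     (\<forall>j\<le>m. monic A (s j) \<and> Cod A (s j) = X) \<and>
     zero_object A (Dom A (s 0)) \<and> iso_arr A (s m) \<and>
     (\<forall>j<m. t j \<in> Hom A (Dom A (s j)) (Dom A (s (Suc j))) \<and>
        Comp A (s (Suc j)) (t j) = s j \<and>
        is_cokernel A (t j) (q j) \<and> Cod A (q j) \<in> C)}"

end

theory Submission
  imports Defs
begin

text \<open>
  Write \<open>E m\<close> for \<open>filtered A C m\<close>. Splitting off the last layer of a filtration shows that the objects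
  of \<open>E (m + 1)\<close> are the extensions of objects of \<open>C\<close> by objects of \<open>E m\<close> (\<open>filtered_Suc\<close>), so
  everything can be proved by induction on lengths of filtrations. Direct sums are then immediate from
  their exactness.

  A morphism need not respect chosen filtrations, and \<open>C\<close> need not be closed under extensions or
  subobjects. The way around this is to treat source and target separately. First let the target of
  \<open>f : X \<rightarrow> Y\<close> lie in \<open>C\<close> and let \<open>X\<close> be an extension of \<open>X''\<close> in \<open>C\<close> by \<open>X'\<close> in \<open>E n\<close>. By
  induction the restriction of \<open>f\<close> to \<open>X'\<close> has kernel in \<open>E n\<close> and cokernel \<open>Q\<close> in \<open>C\<close>. The
  induced map \<open>X'' \<rightarrow> Q\<close> is a morphism in \<open>C\<close>, and by one half of the snake lemma its cokernel is
  \<open>coker f\<close> while \<open>ker f\<close> is an extension of its kernel by the kernel of the restriction. Hence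
  \<open>coker f\<close> lies in \<open>C\<close> and \<open>ker f\<close> lies in \<open>E (n + 1)\<close>
  (\<open>filtered_kernel_cokernel_into_C\<close>). For general \<open>Y\<close>, an extension of \<open>Y''\<close> in \<open>C\<close> by \<open>Y'\<close> in \<open>E m\<close>,
  this applies to \<open>X \<rightarrow> Y''\<close>; the kernel of that map goes to \<open>Y'\<close>, and the dual half of the
  snake lemma assembles \<open>ker f\<close> and \<open>coker f\<close> (\<open>filtered_kernel_cokernel\<close>).

  The snake lemma is proved by chasing generalised elements, i.e. morphisms into an object, which may
  be lifted along epimorphisms after covering their domain by an epimorphism (\<open>lift_along_epic\<close>,
  \<open>lift_along_cokernel\<close>).

  The statement about functors combines two facts. The essential image of a fully faithful exact functor
  has the closure properties required of \<open>C\<close> (\<open>closed_ess_image\<close>): direct sums are transported as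
  biproducts, and kernels and cokernels by way of the image factorisation, because exactness only
  speaks of short exact sequences. And a full subcategory closed under finite direct sums, kernels and
  cokernels is abelian with exact inclusion (\<open>abelian_full_subcat\<close>, \<open>exact_inclusion\<close>), because it
  has the same kernels, cokernels, monomorphisms and epimorphisms as the ambient category.
\<close>

section \<open>Calculus of morphisms\<close>

context category
begin

abbreviation comp_arr (infixr "\<cdot>" 75) where "g \<cdot> f \<equiv> Comp A g f"
abbreviation hom where "hom \<equiv> Hom A"
abbreviation null where "null \<equiv> Zero A"

lemma hom_iff: "f \<in> hom X Y \<longleftrightarrow> f \<in> Arr A \<and> Dom A f = X \<and> Cod A f = Y"
  by (auto simp: Hom_def)

lemma hom_self: "f \<in> Arr A \<Longrightarrow> f \<in> hom (Dom A f) (Cod A f)"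
  by (simp add: hom_iff)

lemma Obj_of_hom: "f \<in> hom X Y \<Longrightarrow> X \<in> Obj A" "f \<in> hom X Y \<Longrightarrow> Y \<in> Obj A"
  using dom_in_Obj cod_in_Obj by (auto simp: hom_iff)

lemma comp_simps [simp]:
  assumes "f \<in> Arr A" "g \<in> Arr A" "Cod A f = Dom A g"
  shows "g \<cdot> f \<in> Arr A" "Dom A (g \<cdot> f) = Dom A f" "Cod A (g \<cdot> f) = Cod A g"
  using comp_in_Hom[of f "Dom A f" "Dom A g" g "Cod A g"] assms by (auto simp: hom_iff)

lemma ide_simps [simp]:
  assumes "X \<in> Obj A"
  shows "Ide A X \<in> Arr A" "Dom A (Ide A X) = X" "Cod A (Ide A X) = X"
  using ide_in_Hom[OF assms] by (auto simp: hom_iff)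

lemma dom_cod_Obj [simp]:
  assumes "f \<in> Arr A" shows "Dom A f \<in> Obj A" "Cod A f \<in> Obj A"
  using assms dom_in_Obj cod_in_Obj by auto

lemma comp_assoc_arr [simp]:
  assumes "f \<in> Arr A" "g \<in> Arr A" "h \<in> Arr A" "Cod A f = Dom A g" "Cod A g = Dom A h"
  shows "(h \<cdot> g) \<cdot> f = h \<cdot> g \<cdot> f"
  using comp_assoc[of f "Dom A f" "Dom A g" g "Dom A h" h "Cod A h"] assms by (auto simp: hom_iff)

lemma comp_ide_arr [simp]:
  assumes "f \<in> Arr A"
  shows "Y = Cod A f \<Longrightarrow> Ide A Y \<cdot> f = f" "X = Dom A f \<Longrightarrow> f \<cdot> Ide A X = f"
  using comp_ide_left comp_ide_right assms by (auto simp: hom_iff)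

text \<open>Composites are normalised to the right, so an equation between two-fold composites has
  to be extended by a further factor before it can be used for rewriting.\<close>

lemma comp_extend:
  assumes "g \<cdot> f = h" "f \<in> Arr A" "g \<in> Arr A" "x \<in> Arr A" "Cod A f = Dom A g" "Cod A x = Dom A f"
  shows "g \<cdot> f \<cdot> x = h \<cdot> x"
  using comp_assoc_arr[of x f g] assms by simp

lemma iso_arrI:
  assumes "f \<in> hom X Y" "g \<in> hom Y X" "g \<cdot> f = Ide A X" "f \<cdot> g = Ide A Y"
  shows "iso_arr A f"
  using assms unfolding iso_arr_def by (auto simp: hom_iff)

lemma iso_arrE:
  assumes "iso_arr A f" "f \<in> hom X Y"
  obtains g where "g \<in> hom Y X" "g \<cdot> f = Ide A X" "f \<cdot> g = Ide A Y"
  using assms unfolding iso_arr_def by (auto simp: hom_iff)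

lemma isomorphicI:
  assumes "f \<in> hom X Y" "g \<in> hom Y X" "g \<cdot> f = Ide A X" "f \<cdot> g = Ide A Y"
  shows "isomorphic A X Y"
  using assms iso_arrI[OF assms] unfolding isomorphic_def by auto

lemma isomorphicE:
  assumes "isomorphic A X Y"
  obtains f g where "f \<in> hom X Y" "g \<in> hom Y X" "g \<cdot> f = Ide A X" "f \<cdot> g = Ide A Y"
  using assms iso_arrE unfolding isomorphic_def by metis

lemma isomorphic_trans:
  assumes "isomorphic A X Y" "isomorphic A Y Z"
  shows "isomorphic A X Z"
proof -
  obtain f g where f: "f \<in> hom X Y" "g \<in> hom Y X" "g \<cdot> f = Ide A X" "f \<cdot> g = Ide A Y"
    using assms(1) by (rule isomorphicE)
  obtain f' g' where f': "f' \<in> hom Y Z" "g' \<in> hom Z Y" "g' \<cdot> f' = Ide A Y" "f' \<cdot> g' = Ide A Z"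
    using assms(2) by (rule isomorphicE)
  show ?thesis
  proof (rule isomorphicI[of "f' \<cdot> f" X Z "g \<cdot> g'"])
    show "(g \<cdot> g') \<cdot> f' \<cdot> f = Ide A X"
      using f f' comp_extend[OF f'(3), of f] by (simp add: hom_iff)
    show "(f' \<cdot> f) \<cdot> g \<cdot> g' = Ide A Z"
      using f f' comp_extend[OF f(4), of g'] by (simp add: hom_iff)
  qed (use f f' in \<open>simp_all add: hom_iff\<close>)
qed

lemma epic_comp:
  assumes "epic A f" "epic A g" "Cod A f = Dom A g"
  shows "epic A (g \<cdot> f)"
  unfolding epic_def
proof (intro conjI allI ballI impI)
  show "g \<cdot> f \<in> Arr A" using assms by (simp add: epic_def)
  fix Z h h'
  assume h: "h \<in> hom (Cod A (g \<cdot> f)) Z" "h' \<in> hom (Cod A (g \<cdot> f)) Z" "h \<cdot> g \<cdot> f = h' \<cdot> g \<cdot> f"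
  have arr: "f \<in> Arr A" "g \<in> Arr A" using assms by (auto simp: epic_def)
  then have "(h \<cdot> g) \<cdot> f = (h' \<cdot> g) \<cdot> f" using h assms(3) by (simp add: hom_iff)
  then have "h \<cdot> g = h' \<cdot> g"
    using assms h arr unfolding epic_def[of A f] by (auto simp: hom_iff)
  then show "h = h'"
    using assms(2) h arr assms(3) unfolding epic_def[of A g] by (auto simp: hom_iff)
qed

end

section \<open>Preadditive categories\<close>

context preadditive_category
begin

abbreviation plus_arr (infixl "\<oplus>" 65) where "f \<oplus> g \<equiv> Add A f g"

lemma null_simps [simp]:
  assumes "X \<in> Obj A" "Y \<in> Obj A"
  shows "null X Y \<in> Arr A" "Dom A (null X Y) = X" "Cod A (null X Y) = Y"
proof -
  interpret comm_group "hom_group A X Y" using hom_comm_group assms .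
  have "null X Y \<in> hom X Y" using one_closed by (simp add: hom_group_def)
  then show "null X Y \<in> Arr A" "Dom A (null X Y) = X" "Cod A (null X Y) = Y"
    by (auto simp: hom_iff)
qed

lemma null_in_hom: "X \<in> Obj A \<Longrightarrow> Y \<in> Obj A \<Longrightarrow> null X Y \<in> hom X Y"
  by (simp add: hom_iff)

lemma add_in_hom: 
  assumes "f \<in> hom X Y" "g \<in> hom X Y" shows "f \<oplus> g \<in> hom X Y"
proof -
  interpret comm_group "hom_group A X Y" using hom_comm_group Obj_of_hom assms by blast
  show ?thesis using m_closed[of f g] assms by (simp add: hom_group_def)
qed

lemma add_simps [simp]:
  assumes "f \<in> Arr A" "g \<in> Arr A" "Dom A f = Dom A g" "Cod A f = Cod A g"
  shows "f \<oplus> g \<in> Arr A" "Dom A (f \<oplus> g) = Dom A g" "Cod A (f \<oplus> g) = Cod A g"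
  using add_in_hom[of f "Dom A g" "Cod A g" g] assms by (auto simp: hom_iff)

lemma add_null [simp]:
  assumes "f \<in> Arr A" "Dom A f = X" "Cod A f = Y"
  shows "null X Y \<oplus> f = f" "f \<oplus> null X Y = f"
proof -
  have f: "f \<in> hom X Y" using assms by (simp add: hom_iff)
  interpret comm_group "hom_group A X Y" using hom_comm_group Obj_of_hom f by blast
  show "null X Y \<oplus> f = f" "f \<oplus> null X Y = f"
    using l_one[of f] r_one[of f] f by (simp_all add: hom_group_def)
qed

lemma add_cancel_left:
  assumes "f \<in> hom X Y" "g \<in> hom X Y" "h \<in> hom X Y" "f \<oplus> g = f \<oplus> h"
  shows "g = h"
proof -
  interpret comm_group "hom_group A X Y" using hom_comm_group Obj_of_hom assms by blast
  show ?thesis using Units_l_cancel[of f g h, unfolded Units_eq] assms by (simp add: hom_group_def)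
qed

lemma obtain_neg:
  assumes "f \<in> hom X Y"
  obtains g where "g \<in> hom X Y" "f \<oplus> g = null X Y"
proof -
  interpret comm_group "hom_group A X Y" using hom_comm_group Obj_of_hom assms by blast
  show ?thesis
    using that[of "inv\<^bsub>hom_group A X Y\<^esub> f"] r_inv[of f] inv_closed[of f] assms
    by (simp add: hom_group_def)
qed

lemma add_comm:
  assumes "f \<in> hom X Y" "g \<in> hom X Y"
  shows "f \<oplus> g = g \<oplus> f"
proof -
  interpret comm_group "hom_group A X Y" using hom_comm_group Obj_of_hom assms by blast
  show ?thesis using m_comm[of f g] assms by (simp add: hom_group_def)
qed

lemma add_cancel_right:
  assumes "f \<in> hom X Y" "g \<in> hom X Y" "h \<in> hom X Y" "g \<oplus> f = h \<oplus> f"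
  shows "g = h"
  using add_cancel_left[of f X Y g h] add_comm assms by metis

lemma comp_add_arr [simp]:
  assumes "f \<in> Arr A" "g \<in> Arr A" "h \<in> Arr A" 
  shows "Dom A f = Dom A g \<Longrightarrow> Cod A f = Cod A g \<Longrightarrow> Cod A g = Dom A h
           \<Longrightarrow> h \<cdot> (f \<oplus> g) = h \<cdot> f \<oplus> h \<cdot> g"
    and "Dom A g = Dom A h \<Longrightarrow> Cod A g = Cod A h \<Longrightarrow> Cod A f = Dom A h
           \<Longrightarrow> (g \<oplus> h) \<cdot> f = g \<cdot> f \<oplus> h \<cdot> f"
  using comp_add_right[of f "Dom A f" "Cod A f" g h "Cod A h"]
    comp_add_left[of f "Dom A f" "Cod A f" g "Cod A g" h] assms by (simp_all add: hom_iff)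

lemma comp_null_right [simp]:
  assumes "f \<in> Arr A" "X \<in> Obj A" "Y = Dom A f"
  shows "f \<cdot> null X Y = null X (Cod A f)"
proof (rule add_cancel_left[of "f \<cdot> null X Y" X "Cod A f"])
  have "f \<cdot> null X Y \<oplus> f \<cdot> null X Y = f \<cdot> (null X Y \<oplus> null X Y)"
    by (rule comp_add_arr(1)[symmetric]) (use assms in auto)
  also have "\<dots> = f \<cdot> null X Y" using assms by simp
  also have "\<dots> = f \<cdot> null X Y \<oplus> null X (Cod A f)" using assms by simp
  finally show "f \<cdot> null X Y \<oplus> f \<cdot> null X Y = f \<cdot> null X Y \<oplus> null X (Cod A f)" .
qed (use assms in \<open>simp_all add: hom_iff\<close>)

lemma comp_null_left [simp]:
  assumes "f \<in> Arr A" "Y \<in> Obj A" "X = Cod A f"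
  shows "null X Y \<cdot> f = null (Dom A f) Y"
proof (rule add_cancel_left[of "null X Y \<cdot> f" "Dom A f" Y])
  have "null X Y \<cdot> f \<oplus> null X Y \<cdot> f = (null X Y \<oplus> null X Y) \<cdot> f"
    by (rule comp_add_arr(2)[symmetric]) (use assms in auto)
  also have "\<dots> = null X Y \<cdot> f" using assms by simp
  also have "\<dots> = null X Y \<cdot> f \<oplus> null (Dom A f) Y" using assms by simp
  finally show "null X Y \<cdot> f \<oplus> null X Y \<cdot> f = null X Y \<cdot> f \<oplus> null (Dom A f) Y" .
qed (use assms in \<open>simp_all add: hom_iff\<close>)

lemma monicI:
  assumes "f \<in> hom X Y" "\<And>Z g. g \<in> hom Z X \<Longrightarrow> f \<cdot> g = null Z Y \<Longrightarrow> g = null Z X"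
  shows "monic A f"
  unfolding monic_def
proof (intro conjI allI ballI impI)
  show "f \<in> Arr A" using assms by (simp add: hom_iff)
  fix Z g h
  assume "g \<in> hom Z (Dom A f)" "h \<in> hom Z (Dom A f)" and eq: "f \<cdot> g = f \<cdot> h"
  then have gh: "g \<in> hom Z X" "h \<in> hom Z X" using assms by (auto simp: hom_iff)
  obtain n where n: "n \<in> hom Z X" "h \<oplus> n = null Z X" using obtain_neg gh by blast
  have "f \<cdot> (g \<oplus> n) = f \<cdot> (h \<oplus> n)"
    using comp_add_arr(1)[of _ n f] eq gh n(1) assms(1) by (simp add: hom_iff)
  also have "\<dots> = null Z Y" unfolding n(2) using assms(1) gh by (auto simp: hom_iff)
  finally have "g \<oplus> n = null Z X" using assms(2) gh n add_in_hom by blast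
  then show "g = h" using add_cancel_right[OF n(1) gh] n(2) by simp
qed

lemma epicI:
  assumes "f \<in> hom X Y" "\<And>Z g. g \<in> hom Y Z \<Longrightarrow> g \<cdot> f = null X Z \<Longrightarrow> g = null Y Z"
  shows "epic A f"
  unfolding epic_def
proof (intro conjI allI ballI impI)
  show "f \<in> Arr A" using assms by (simp add: hom_iff)
  fix Z g h
  assume "g \<in> hom (Cod A f) Z" "h \<in> hom (Cod A f) Z" and eq: "g \<cdot> f = h \<cdot> f"
  then have gh: "g \<in> hom Y Z" "h \<in> hom Y Z" using assms by (auto simp: hom_iff)
  obtain n where n: "n \<in> hom Y Z" "h \<oplus> n = null Y Z" using obtain_neg gh by blast
  have "(g \<oplus> n) \<cdot> f = (h \<oplus> n) \<cdot> f"
    using comp_add_arr(2)[of f _ n] eq gh n(1) assms(1) by (simp add: hom_iff)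
  also have "\<dots> = null X Z" unfolding n(2) using assms(1) gh by (auto simp: hom_iff)
  finally have "g \<oplus> n = null Y Z" using assms(2) gh n add_in_hom by blast
  then show "g = h" using add_cancel_right[OF n(1) gh] n(2) by simp
qed

end

section \<open>Direct sums and biproducts\<close>

text \<open>Defined by recursion over the index, because \<open>Add\<close> is a group operation only on each set of
  parallel morphisms and has a different neutral element on each of them.\<close>

primrec partial_sum :: "('o, 'm) precat \<Rightarrow> 'o \<Rightarrow> 'o \<Rightarrow> (nat \<Rightarrow> 'm) \<Rightarrow> nat \<Rightarrow> 'm" where
  "partial_sum A X Y g 0 = Zero A X Y"
| "partial_sum A X Y g (Suc n) = Add A (partial_sum A X Y g n) (g n)"

context category
begin

lemma monic_cancel:
  assumes "monic A f" "f \<in> hom X Y" "g \<in> hom Z X" "h \<in> hom Z X" "f \<cdot> g = f \<cdot> h"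
  shows "g = h"
  using assms unfolding monic_def by (auto simp: hom_iff)

lemma epic_cancel:
  assumes "epic A f" "f \<in> hom X Y" "g \<in> hom Y Z" "h \<in> hom Y Z" "g \<cdot> f = h \<cdot> f"
  shows "g = h"
  using assms unfolding epic_def by (auto simp: hom_iff)

lemma direct_sumD:
  assumes "is_direct_sum A n Y X i"
  shows "X \<in> Obj A" "\<And>k. k < n \<Longrightarrow> Y k \<in> Obj A" "\<And>k. k < n \<Longrightarrow> i k \<in> hom (Y k) X"
  using assms unfolding is_direct_sum_def by auto

lemma direct_sum_ext:
  assumes "is_direct_sum A n Y X i" "h \<in> hom X Z" "h' \<in> hom X Z"
    "\<And>k. k < n \<Longrightarrow> h \<cdot> i k = h' \<cdot> i k"
  shows "h = h'"
proof -
  have Z: "Z \<in> Obj A" using Obj_of_hom assms(2) by blast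
  have "\<forall>k<n. h \<cdot> i k \<in> hom (Y k) Z"
    using direct_sumD(3)[OF assms(1)] assms(2) comp_in_Hom by blast
  then have "\<exists>!e. e \<in> hom X Z \<and> (\<forall>k<n. e \<cdot> i k = h \<cdot> i k)"
    using assms(1) Z unfolding is_direct_sum_def by auto
  then show ?thesis using assms(2-4) by metis
qed

lemma direct_sum_copair:
  assumes "is_direct_sum A n Y X i" "Z \<in> Obj A" "\<And>k. k < n \<Longrightarrow> g k \<in> hom (Y k) Z"
  obtains h where "h \<in> hom X Z" "\<And>k. k < n \<Longrightarrow> h \<cdot> i k = g k"
  using assms unfolding is_direct_sum_def by metis

lemma direct_sum_unique:
  assumes "is_direct_sum A n Y X i" "is_direct_sum A n Y X' i'"
  shows "isomorphic A X X'"
proof -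
  note D = direct_sumD[OF assms(1)] and D' = direct_sumD[OF assms(2)]
  obtain f where f: "f \<in> hom X X'" "\<And>k. k < n \<Longrightarrow> f \<cdot> i k = i' k"
    using direct_sum_copair[OF assms(1) D'(1) D'(3)] by blast
  obtain g where g: "g \<in> hom X' X" "\<And>k. k < n \<Longrightarrow> g \<cdot> i' k = i k"
    using direct_sum_copair[OF assms(2) D(1) D(3)] by blast
  show ?thesis
  proof (rule isomorphicI[OF f(1) g(1)])
    show "g \<cdot> f = Ide A X"
    proof (rule direct_sum_ext[OF assms(1)])
      fix k assume k: "k < n"
      show "(g \<cdot> f) \<cdot> i k = Ide A X \<cdot> i k"
        using f(1) f(2)[OF k] g(1) g(2)[OF k] D(3)[OF k] by (auto simp: hom_iff)
    qed (use f g D(1) in \<open>auto simp: hom_iff\<close>)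
    show "f \<cdot> g = Ide A X'"
    proof (rule direct_sum_ext[OF assms(2)])
      fix k assume k: "k < n"
      show "(f \<cdot> g) \<cdot> i' k = Ide A X' \<cdot> i' k"
        using f(1) f(2)[OF k] g(1) g(2)[OF k] D'(3)[OF k] by (auto simp: hom_iff)
    qed (use f g D'(1) in \<open>auto simp: hom_iff\<close>)
  qed
qed

lemma direct_sum_transport:
  assumes "is_direct_sum A n Y X i"
    and "\<And>k. k < n \<Longrightarrow> a k \<in> hom (W k) (Y k)" "\<And>k. k < n \<Longrightarrow> b k \<in> hom (Y k) (W k)"
    and "\<And>k. k < n \<Longrightarrow> a k \<cdot> b k = Ide A (Y k)" "\<And>k. k < n \<Longrightarrow> b k \<cdot> a k = Ide A (W k)"
  shows "is_direct_sum A n W X (\<lambda>k. i k \<cdot> a k)"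
  unfolding is_direct_sum_def
proof (intro conjI allI ballI impI)
  note D = direct_sumD[OF assms(1)]
  show "X \<in> Obj A" by fact
  show "W k \<in> Obj A" "i k \<cdot> a k \<in> hom (W k) X" if "k < n" for k
    using D assms(2)[OF that] that comp_in_Hom Obj_of_hom by blast+
  fix Z g assume Z: "Z \<in> Obj A" and g: "\<forall>k<n. g k \<in> hom (W k) Z"
  obtain h where h: "h \<in> hom X Z" "\<And>k. k < n \<Longrightarrow> h \<cdot> i k = g k \<cdot> b k"
    by (rule direct_sum_copair[OF assms(1) Z, of "\<lambda>k. g k \<cdot> b k"])
      (use g assms(3) comp_in_Hom in blast)+
  show "\<exists>!h. h \<in> hom X Z \<and> (\<forall>k<n. h \<cdot> i k \<cdot> a k = g k)"
  proof (rule ex1I[of _ h])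
    have "h \<cdot> i k \<cdot> a k = g k" if k: "k < n" for k
    proof -
      have "h \<cdot> i k \<cdot> a k = (h \<cdot> i k) \<cdot> a k"
        using h(1) D(3)[OF k] assms(2)[OF k] by (simp add: hom_iff)
      also have "\<dots> = g k"
        unfolding h(2)[OF k] using g k assms(2,3,5)[OF k] by (simp add: hom_iff)
      finally show ?thesis .
    qed
    then show "h \<in> hom X Z \<and> (\<forall>k<n. h \<cdot> i k \<cdot> a k = g k)" using h(1) by blast
  next
    fix h' assume h': "h' \<in> hom X Z \<and> (\<forall>k<n. h' \<cdot> i k \<cdot> a k = g k)"
    show "h' = h"
    proof (rule direct_sum_ext[OF assms(1)])
      fix k assume k: "k < n"
      have "h' \<cdot> i k = (h' \<cdot> i k \<cdot> a k) \<cdot> b k"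
        using h' D(3)[OF k] assms(2-4)[OF k] by (simp add: hom_iff)
      then show "h' \<cdot> i k = h \<cdot> i k" using h' h(2)[OF k] k by simp
    qed (use h h' in auto)
  qed
qed

end

context preadditive_category
begin

lemma partial_sum_in_hom:
  assumes "X \<in> Obj A" "Y \<in> Obj A" "\<And>k. k < n \<Longrightarrow> g k \<in> hom X Y" "j \<le> n"
  shows "partial_sum A X Y g j \<in> hom X Y"
  using assms(4) by (induction j) (use assms null_in_hom add_in_hom in auto)

lemma partial_sum_cong:
  "(\<And>k. k < j \<Longrightarrow> g k = h k) \<Longrightarrow> partial_sum A X Y g j = partial_sum A X Y h j"
  by (induction j) auto

lemma comp_partial_sum:
  assumes "h \<in> hom Y Z" "X \<in> Obj A" "\<And>k. k < j \<Longrightarrow> g k \<in> hom X Y"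
  shows "h \<cdot> partial_sum A X Y g j = partial_sum A X Z (\<lambda>k. h \<cdot> g k) j"
  using assms(3)
proof (induction j)
  case 0
  then show ?case using assms by (auto simp: hom_iff)
next
  case (Suc j)
  have "partial_sum A X Y g j \<in> hom X Y" "g j \<in> hom X Y"
    using partial_sum_in_hom[of X Y "Suc j" g j] Suc.prems Obj_of_hom assms by auto
  then show ?case using Suc assms by (auto simp: hom_iff)
qed

lemma partial_sum_comp:
  assumes "h \<in> hom W X" "Y \<in> Obj A" "\<And>k. k < j \<Longrightarrow> g k \<in> hom X Y"
  shows "partial_sum A X Y g j \<cdot> h = partial_sum A W Y (\<lambda>k. g k \<cdot> h) j"
  using assms(3)
proof (induction j)
  case 0
  then show ?case using assms by (auto simp: hom_iff)
next
  case (Suc j)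
  have "partial_sum A X Y g j \<in> hom X Y" "g j \<in> hom X Y"
    using partial_sum_in_hom[of X Y "Suc j" g j] Suc.prems Obj_of_hom assms by auto
  then show ?case using Suc assms by (auto simp: hom_iff)
qed

lemma partial_sum_null:
  assumes "X \<in> Obj A" "Y \<in> Obj A" "\<And>k. k < j \<Longrightarrow> g k = null X Y"
  shows "partial_sum A X Y g j = null X Y"
  using assms(3) by (induction j) (use assms in auto)

lemma partial_sum_single:
  assumes "\<And>k. k < n \<Longrightarrow> g k = (if k = l then f else null X Y)" "f \<in> hom X Y" "j \<le> n"
  shows "partial_sum A X Y g j = (if l < j then f else null X Y)"
  using assms(3)
proof (induction j)
  case (Suc j)
  then show ?case using assms(1)[of j] assms(2) Obj_of_hom[OF assms(2)] by (auto simp: hom_iff)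
qed simp

text \<open>A biproduct: projections \<open>p\<close> dual to the injections \<open>i\<close> with \<open>\<Sum>\<^sub>k i\<^sub>k p\<^sub>k = 1\<close>. This is
  an equational condition, hence it is preserved by additive functors.\<close>

definition is_biproduct ::
  "nat \<Rightarrow> (nat \<Rightarrow> 'o) \<Rightarrow> 'o \<Rightarrow> (nat \<Rightarrow> 'm) \<Rightarrow> (nat \<Rightarrow> 'm) \<Rightarrow> bool" where
  "is_biproduct n Y X i p \<longleftrightarrow> X \<in> Obj A \<and>
     (\<forall>k<n. Y k \<in> Obj A \<and> i k \<in> hom (Y k) X \<and> p k \<in> hom X (Y k)) \<and>
     (\<forall>k<n. \<forall>l<n. p k \<cdot> i l = (if l = k then Ide A (Y k) else null (Y l) (Y k))) \<and>
     partial_sum A X X (\<lambda>k. i k \<cdot> p k) n = Ide A X"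

lemma biproductD:
  assumes "is_biproduct n Y X i p"
  shows "X \<in> Obj A" "\<And>k. k < n \<Longrightarrow> Y k \<in> Obj A" "\<And>k. k < n \<Longrightarrow> i k \<in> hom (Y k) X"
    "\<And>k. k < n \<Longrightarrow> p k \<in> hom X (Y k)"
    "\<And>k l. k < n \<Longrightarrow> l < n \<Longrightarrow> p k \<cdot> i l = (if l = k then Ide A (Y k) else null (Y l) (Y k))"
    "partial_sum A X X (\<lambda>k. i k \<cdot> p k) n = Ide A X"
  using assms unfolding is_biproduct_def by auto

lemma direct_sum_biproduct:
  assumes "is_direct_sum A n Y X i"
  obtains p where "is_biproduct n Y X i p"
proof -
  note D = direct_sumD[OF assms]
  have "\<exists>p. p \<in> hom X (Y k) \<and>
      (\<forall>l<n. p \<cdot> i l = (if l = k then Ide A (Y k) else null (Y l) (Y k)))" if k: "k < n" for k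
    by (rule direct_sum_copair[OF assms D(2)[OF k],
          of "\<lambda>l. if l = k then Ide A (Y k) else null (Y l) (Y k)"])
      (use D(2) k in \<open>auto simp: hom_iff\<close>)
  then obtain p where p: "\<And>k. k < n \<Longrightarrow> p k \<in> hom X (Y k)"
    "\<And>k l. k < n \<Longrightarrow> l < n \<Longrightarrow> p k \<cdot> i l = (if l = k then Ide A (Y k) else null (Y l) (Y k))"
    by metis
  have ip: "i k \<cdot> p k \<in> hom X X" if "k < n" for k
    using D(3) p(1) that comp_in_Hom by blast
  have "partial_sum A X X (\<lambda>k. i k \<cdot> p k) n = Ide A X"
  proof (rule direct_sum_ext[OF assms])
    show "partial_sum A X X (\<lambda>k. i k \<cdot> p k) n \<in> hom X X"
      by (rule partial_sum_in_hom[of X X n]) (use ip D(1) in auto)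
    show "Ide A X \<in> hom X X" using D(1) ide_in_Hom by blast
    fix l assume l: "l < n"
    have "partial_sum A X X (\<lambda>k. i k \<cdot> p k) n \<cdot> i l =
        partial_sum A (Y l) X (\<lambda>k. (i k \<cdot> p k) \<cdot> i l) n"
      by (rule partial_sum_comp) (use D l ip in auto)
    also have "\<dots> = i l"
    proof (subst partial_sum_single[of n _ l "i l" "Y l" X n])
      fix k assume k: "k < n"
      show "(i k \<cdot> p k) \<cdot> i l = (if k = l then i l else null (Y l) X)"
        using D(1) D(2)[OF k] D(2)[OF l] D(3)[OF k] D(3)[OF l] p(1)[OF k] p(2)[OF k l]
        by (auto simp: hom_iff)
    qed (use D l in auto)
    finally show "partial_sum A X X (\<lambda>k. i k \<cdot> p k) n \<cdot> i l = Ide A X \<cdot> i l"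
      using D(1) D(3)[OF l] by (simp add: hom_iff)
  qed
  then have "is_biproduct n Y X i p" unfolding is_biproduct_def using D p by auto
  then show ?thesis by (rule that)
qed

lemma biproduct_direct_sum:
  assumes "is_biproduct n Y X i p"
  shows "is_direct_sum A n Y X i"
  unfolding is_direct_sum_def
proof (intro conjI allI ballI impI)
  note D = biproductD[OF assms]
  show "X \<in> Obj A" "\<And>k. k < n \<Longrightarrow> Y k \<in> Obj A" "\<And>k. k < n \<Longrightarrow> i k \<in> hom (Y k) X"
    using D by auto
  fix Z g assume Z: "Z \<in> Obj A" and g: "\<forall>k<n. g k \<in> hom (Y k) Z"
  let ?h = "partial_sum A X Z (\<lambda>k. g k \<cdot> p k) n"
  have gp: "g k \<cdot> p k \<in> hom X Z" if "k < n" for k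
    using g D(4) that comp_in_Hom by blast
  have "?h \<cdot> i l = g l" if l: "l < n" for l
  proof -
    have "?h \<cdot> i l = partial_sum A (Y l) Z (\<lambda>k. (g k \<cdot> p k) \<cdot> i l) n"
      by (rule partial_sum_comp) (use D l gp Z in auto)
    also have "\<dots> = g l"
    proof (subst partial_sum_single[of n _ l "g l" "Y l" Z n])
      fix k assume k: "k < n"
      then have "g k \<in> hom (Y k) Z" "g l \<in> hom (Y l) Z" using g l by auto
      then show "(g k \<cdot> p k) \<cdot> i l = (if k = l then g l else null (Y l) Z)"
        using D(1) D(2)[OF k] D(2)[OF l] D(3)[OF k] D(3)[OF l] D(4)[OF k] D(5)[OF k l] Z
        by (auto simp: hom_iff)
    qed (use g l in auto)
    finally show ?thesis .
  qed
  moreover have "?h \<in> hom X Z" by (rule partial_sum_in_hom[of X Z n]) (use gp D(1) Z in auto)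
  moreover have "h = h'" if h: "h \<in> hom X Z" "h' \<in> hom X Z" "\<And>k. k < n \<Longrightarrow> h \<cdot> i k = h' \<cdot> i k" for h h'
  proof -
    have *: "e = partial_sum A X Z (\<lambda>k. (e \<cdot> i k) \<cdot> p k) n" if e: "e \<in> hom X Z" for e
    proof -
      have "e = e \<cdot> partial_sum A X X (\<lambda>k. i k \<cdot> p k) n"
        using e D(6) by (simp add: hom_iff)
      also have "\<dots> = partial_sum A X Z (\<lambda>k. e \<cdot> i k \<cdot> p k) n"
        by (rule comp_partial_sum) (use e D(1) comp_in_Hom[OF D(4,3)] in auto)
      also have "\<dots> = partial_sum A X Z (\<lambda>k. (e \<cdot> i k) \<cdot> p k) n"
        by (rule partial_sum_cong) (use comp_assoc[OF D(4) D(3) e] in auto)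
      finally show ?thesis .
    qed
    have "partial_sum A X Z (\<lambda>k. (h \<cdot> i k) \<cdot> p k) n = partial_sum A X Z (\<lambda>k. (h' \<cdot> i k) \<cdot> p k) n"
      by (rule partial_sum_cong) (simp add: h(3))
    then show ?thesis using *[OF h(1)] *[OF h(2)] by simp
  qed
  ultimately show "\<exists>!h. h \<in> hom X Z \<and> (\<forall>k<n. h \<cdot> i k = g k)" by (metis (no_types, lifting))
qed

lemma biproduct_projections_jointly_monic:
  assumes "is_biproduct n Y X i p" "a \<in> hom T X" "\<And>k. k < n \<Longrightarrow> p k \<cdot> a = null T (Y k)"
  shows "a = null T X"
proof -
  note D = biproductD[OF assms(1)]
  have T: "T \<in> Obj A" using Obj_of_hom assms(2) by blast
  have "a = partial_sum A X X (\<lambda>k. i k \<cdot> p k) n \<cdot> a" using D(6) assms(2) by (simp add: hom_iff)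
  also have "\<dots> = partial_sum A T X (\<lambda>k. (i k \<cdot> p k) \<cdot> a) n"
    by (rule partial_sum_comp) (use assms D(1) comp_in_Hom[OF D(4,3)] in auto)
  also have "\<dots> = null T X"
  proof (rule partial_sum_null)
    fix k assume k: "k < n"
    show "(i k \<cdot> p k) \<cdot> a = null T X"
      using assms(2) assms(3)[OF k] D(2-4)[OF k] T by (auto simp: hom_iff)
  qed (use T D in auto)
  finally show ?thesis .
qed

section \<open>Kernels and cokernels\<close>

lemma kernelD:
  assumes "is_kernel A f k" "f \<in> hom X Y"
  shows "k \<in> hom (Dom A k) X" "f \<cdot> k = null (Dom A k) Y" "monic A k"
proof -
  show k: "k \<in> hom (Dom A k) X" and z: "f \<cdot> k = null (Dom A k) Y"
    using assms unfolding is_kernel_def by (auto simp: hom_iff)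
  show "monic A k"
  proof (rule monicI[OF k])
    fix Z g assume g: "g \<in> hom Z (Dom A k)" "k \<cdot> g = null Z X"
    have "null Z X \<in> hom Z (Dom A f)" "f \<cdot> null Z X = null Z (Cod A f)"
      using g assms Obj_of_hom[OF g(1)] Obj_of_hom[OF assms(2)] by (auto simp: hom_iff)
    then have "\<exists>!h. h \<in> hom Z (Dom A k) \<and> k \<cdot> h = null Z X"
      using assms(1) unfolding is_kernel_def by blast
    moreover have "null Z (Dom A k) \<in> hom Z (Dom A k)" "k \<cdot> null Z (Dom A k) = null Z X"
      using k g Obj_of_hom[OF g(1)] Obj_of_hom[OF k] by (auto simp: hom_iff)
    ultimately show "g = null Z (Dom A k)" using g by metis
  qed
qed

lemma kernel_lift:
  assumes "is_kernel A f k" "f \<in> hom X Y" "g \<in> hom Z X" "f \<cdot> g = null Z Y"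
  obtains h where "h \<in> hom Z (Dom A k)" "k \<cdot> h = g"
proof -
  have "\<exists>!h. h \<in> hom Z (Dom A k) \<and> k \<cdot> h = g"
    using assms unfolding is_kernel_def by (simp add: hom_iff)
  then show ?thesis using that by blast
qed

lemma kernelI:
  assumes "f \<in> hom X Y" "k \<in> hom K X" "f \<cdot> k = null K Y" "monic A k"
    "\<And>Z g. g \<in> hom Z X \<Longrightarrow> f \<cdot> g = null Z Y \<Longrightarrow> \<exists>h. h \<in> hom Z K \<and> k \<cdot> h = g"
  shows "is_kernel A f k"
  unfolding is_kernel_def
proof (intro conjI allI ballI impI)
  fix Z g assume g: "g \<in> hom Z (Dom A f)" "f \<cdot> g = null Z (Cod A f)"
  then obtain h where "h \<in> hom Z K" "k \<cdot> h = g" using assms(1,5) by (auto simp: hom_iff)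
  then show "\<exists>!h. h \<in> hom Z (Dom A k) \<and> k \<cdot> h = g"
    using monic_cancel[OF assms(4,2)] assms(2) by (metis hom_iff)
qed (use assms in \<open>auto simp: hom_iff\<close>)

lemma cokernelD:
  assumes "is_cokernel A f q" "f \<in> hom X Y"
  shows "q \<in> hom Y (Cod A q)" "q \<cdot> f = null X (Cod A q)" "epic A q"
proof -
  show q: "q \<in> hom Y (Cod A q)" and z: "q \<cdot> f = null X (Cod A q)"
    using assms unfolding is_cokernel_def by (auto simp: hom_iff)
  show "epic A q"
  proof (rule epicI[OF q])
    fix Z g assume g: "g \<in> hom (Cod A q) Z" "g \<cdot> q = null Y Z"
    have "null Y Z \<in> hom (Cod A f) Z" "null Y Z \<cdot> f = null (Dom A f) Z"
      using g assms Obj_of_hom[OF g(1)] Obj_of_hom[OF assms(2)] by (auto simp: hom_iff)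
    then have "\<exists>!h. h \<in> hom (Cod A q) Z \<and> h \<cdot> q = null Y Z"
      using assms(1) unfolding is_cokernel_def by blast
    moreover have "null (Cod A q) Z \<in> hom (Cod A q) Z" "null (Cod A q) Z \<cdot> q = null Y Z"
      using q g Obj_of_hom[OF g(1)] Obj_of_hom[OF q] by (auto simp: hom_iff)
    ultimately show "g = null (Cod A q) Z" using g by metis
  qed
qed

lemma cokernel_lift:
  assumes "is_cokernel A f q" "f \<in> hom X Y" "g \<in> hom Y Z" "g \<cdot> f = null X Z"
  obtains h where "h \<in> hom (Cod A q) Z" "h \<cdot> q = g"
proof -
  have "\<exists>!h. h \<in> hom (Cod A q) Z \<and> h \<cdot> q = g"
    using assms unfolding is_cokernel_def by (simp add: hom_iff)
  then show ?thesis using that by blast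
qed

lemma cokernelI:
  assumes "f \<in> hom X Y" "q \<in> hom Y Q" "q \<cdot> f = null X Q" "epic A q"
    "\<And>Z g. g \<in> hom Y Z \<Longrightarrow> g \<cdot> f = null X Z \<Longrightarrow> \<exists>h. h \<in> hom Q Z \<and> h \<cdot> q = g"
  shows "is_cokernel A f q"
  unfolding is_cokernel_def
proof (intro conjI allI ballI impI)
  fix Z g assume g: "g \<in> hom (Cod A f) Z" "g \<cdot> f = null (Dom A f) Z"
  then obtain h where "h \<in> hom Q Z" "h \<cdot> q = g" using assms(1,5) by (auto simp: hom_iff)
  then show "\<exists>!h. h \<in> hom (Cod A q) Z \<and> h \<cdot> q = g"
    using epic_cancel[OF assms(4,2)] assms(2) by (metis hom_iff)
qed (use assms in \<open>auto simp: hom_iff\<close>)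

lemma monic_null:
  assumes "f \<cdot> g = null Z Y" "monic A f" "f \<in> hom X Y" "g \<in> hom Z X"
  shows "g = null Z X"
  by (rule monic_cancel[OF assms(2,3,4)])
    (use assms Obj_of_hom[OF assms(3)] Obj_of_hom[OF assms(4)] in \<open>auto simp: hom_iff\<close>)

lemma epic_null:
  assumes "g \<cdot> f = null X Z" "epic A f" "f \<in> hom X Y" "g \<in> hom Y Z"
  shows "g = null Y Z"
  by (rule epic_cancel[OF assms(2,3,4)])
    (use assms Obj_of_hom[OF assms(3)] Obj_of_hom[OF assms(4)] in \<open>auto simp: hom_iff\<close>)

lemma kernel_unique:
  assumes "is_kernel A f k" "is_kernel A f k'"
  shows "isomorphic A (Dom A k) (Dom A k')"
proof -
  have f: "f \<in> hom (Dom A f) (Cod A f)" using assms unfolding is_kernel_def by (simp add: hom_self)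
  note K = kernelD[OF assms(1) f] and K' = kernelD[OF assms(2) f]
  obtain a where a: "a \<in> hom (Dom A k) (Dom A k')" "k' \<cdot> a = k" by (rule kernel_lift[OF assms(2) f K(1,2)])
  obtain b where b: "b \<in> hom (Dom A k') (Dom A k)" "k \<cdot> b = k'" by (rule kernel_lift[OF assms(1) f K'(1,2)])
  have k: "k \<in> Arr A" "k' \<in> Arr A" using K K' by (auto simp: hom_iff)
  show ?thesis
  proof (rule isomorphicI[OF a(1) b(1)])
    show "b \<cdot> a = Ide A (Dom A k)"
      by (rule monic_cancel[OF K(3,1) comp_in_Hom[OF a(1) b(1)]])
       (use a b k comp_extend[OF b(2), of a] in \<open>simp_all add: hom_iff\<close>)
    show "a \<cdot> b = Ide A (Dom A k')"
      by (rule monic_cancel[OF K'(3,1) comp_in_Hom[OF b(1) a(1)]])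
       (use a b k comp_extend[OF a(2), of b] in \<open>simp_all add: hom_iff\<close>)
  qed
qed

lemma cokernel_unique:
  assumes "is_cokernel A f q" "is_cokernel A f q'"
  shows "isomorphic A (Cod A q) (Cod A q')"
proof -
  have f: "f \<in> hom (Dom A f) (Cod A f)" using assms unfolding is_cokernel_def by (simp add: hom_self)
  note Q = cokernelD[OF assms(1) f] and Q' = cokernelD[OF assms(2) f]
  obtain a where a: "a \<in> hom (Cod A q) (Cod A q')" "a \<cdot> q = q'" by (rule cokernel_lift[OF assms(1) f Q'(1,2)])
  obtain b where b: "b \<in> hom (Cod A q') (Cod A q)" "b \<cdot> q' = q" by (rule cokernel_lift[OF assms(2) f Q(1,2)])
  have q: "q \<in> Arr A" "q' \<in> Arr A" using Q Q' by (auto simp: hom_iff)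
  show ?thesis
  proof (rule isomorphicI[OF a(1) b(1)])
    show "b \<cdot> a = Ide A (Cod A q)"
      by (rule epic_cancel[OF Q(3,1) comp_in_Hom[OF a(1) b(1)]])
       (use a b q in \<open>simp_all add: hom_iff\<close>)
    show "a \<cdot> b = Ide A (Cod A q')"
      by (rule epic_cancel[OF Q'(3,1) comp_in_Hom[OF b(1) a(1)]])
       (use a b q in \<open>simp_all add: hom_iff\<close>)
  qed
qed

text \<open>A kernel only depends on which composites with \<open>f\<close> vanish, and monomorphisms reflect vanishing;
  dually for cokernels and epimorphisms.\<close>

lemma kernel_comp_monic:
  assumes "is_kernel A f k" "f \<in> hom X Y" "monic A g" "g \<in> hom Y Z"
  shows "is_kernel A (g \<cdot> f) k"
proof (rule kernelI[of _ X Z])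
  note K = kernelD[OF assms(1,2)]
  have O: "Dom A k \<in> Obj A" using K(1) Obj_of_hom by blast
  show "k \<in> hom (Dom A k) X" "monic A k" "g \<cdot> f \<in> hom X Z" using K assms comp_in_Hom by auto
  show "(g \<cdot> f) \<cdot> k = null (Dom A k) Z"
    using K(1,2) assms(2,4) O by (auto simp: hom_iff)
  fix W h assume h: "h \<in> hom W X" "(g \<cdot> f) \<cdot> h = null W Z"
  have W: "W \<in> Obj A" using Obj_of_hom h by blast
  have "f \<cdot> h = null W Y"
    by (rule monic_cancel[OF assms(3,4)]) (use assms(2,4) W h in \<open>auto simp: hom_iff\<close>)
  then show "\<exists>e. e \<in> hom W (Dom A k) \<and> k \<cdot> e = h"
    using kernel_lift[OF assms(1,2) h(1)] by metis
qed

lemma cokernel_comp_epic: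
  assumes "is_cokernel A f q" "f \<in> hom X Y" "epic A g" "g \<in> hom W X"
  shows "is_cokernel A (f \<cdot> g) q"
proof (rule cokernelI[of _ W Y])
  note Q = cokernelD[OF assms(1,2)]
  have O: "Cod A q \<in> Obj A" "W \<in> Obj A" using Q(1) assms(4) Obj_of_hom by blast+
  show "q \<in> hom Y (Cod A q)" "epic A q" "f \<cdot> g \<in> hom W Y" using Q assms comp_in_Hom by auto
  show "q \<cdot> f \<cdot> g = null W (Cod A q)"
    using Q(1) assms(2,4) O comp_extend[OF Q(2), of g] by (auto simp: hom_iff)
  fix Z h assume h: "h \<in> hom Y Z" "h \<cdot> f \<cdot> g = null W Z"
  have Z: "Z \<in> Obj A" using Obj_of_hom h by blast
  have "h \<cdot> f = null X Z"
    by (rule epic_cancel[OF assms(3,4)]) (use assms(2,4) Z h in \<open>auto simp: hom_iff\<close>)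
  then show "\<exists>e. e \<in> hom (Cod A q) Z \<and> e \<cdot> q = h"
    using cokernel_lift[OF assms(1,2) h(1)] by metis
qed

end

section \<open>Abelian categories: lifting along epimorphisms\<close>

context abelian_category
begin

lemma obtain_kernel:
  assumes "f \<in> hom X Y"
  obtains k where "is_kernel A f k" "k \<in> hom (Dom A k) X" "f \<cdot> k = null (Dom A k) Y" "monic A k"
    "Dom A k \<in> Obj A"
  using has_kernels kernelD Obj_of_hom assms by (metis hom_iff)

lemma obtain_cokernel:
  assumes "f \<in> hom X Y"
  obtains q where "is_cokernel A f q" "q \<in> hom Y (Cod A q)" "q \<cdot> f = null X (Cod A q)" "epic A q"
    "Cod A q \<in> Obj A"
  using has_cokernels cokernelD Obj_of_hom assms by (metis hom_iff)

text \<open>Whatever \<open>e\<close> is a cokernel of factors through the kernel of \<open>e\<close>, so a morphism that kills the kernel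
  kills it too. The next lemma is dual.\<close>

lemma epic_is_cokernel_of_kernel:
  assumes "epic A e" "e \<in> hom X Y" "is_kernel A e k"
  shows "is_cokernel A k e"
proof (rule cokernelI)
  note K = kernelD[OF assms(3,2)]
  show "k \<in> hom (Dom A k) X" "e \<in> hom X Y" "epic A e" "e \<cdot> k = null (Dom A k) Y"
    using K assms by auto
  obtain g where g: "is_cokernel A g e" using epic_is_cokernel assms(1) by blast
  have gh: "g \<in> hom (Dom A g) X" using g assms(2) unfolding is_cokernel_def by (auto simp: hom_iff)
  have "e \<cdot> g = null (Dom A g) Y" using cokernelD(2)[OF g gh] assms(2) by (simp add: hom_iff)
  then obtain l where l: "l \<in> hom (Dom A g) (Dom A k)" "k \<cdot> l = g"
    using kernel_lift[OF assms(3,2) gh] by blast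
  fix Z h assume h: "h \<in> hom X Z" "h \<cdot> k = null (Dom A k) Z"
  have "h \<cdot> g = null (Dom A g) Z"
    unfolding l(2)[symmetric]
    using comp_extend[OF h(2), of l] h(1) l(1) K(1) Obj_of_hom[OF h(1)] Obj_of_hom[OF gh]
    by (simp add: hom_iff)
  then show "\<exists>e'. e' \<in> hom Y Z \<and> e' \<cdot> e = h"
    using cokernel_lift[OF g gh h(1)] assms(2) by (metis hom_iff)
qed

lemma monic_is_kernel_of_cokernel:
  assumes "monic A m" "m \<in> hom X Y" "is_cokernel A m q"
  shows "is_kernel A q m"
proof (rule kernelI)
  note Q = cokernelD[OF assms(3,2)]
  show "q \<in> hom Y (Cod A q)" "m \<in> hom X Y" "monic A m" "q \<cdot> m = null X (Cod A q)"
    using Q assms by auto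
  obtain g where g: "is_kernel A g m" using monic_is_kernel assms(1) by blast
  have gh: "g \<in> hom Y (Cod A g)" using g assms(2) unfolding is_kernel_def by (auto simp: hom_iff)
  have "g \<cdot> m = null X (Cod A g)" using kernelD(2)[OF g gh] assms(2) by (simp add: hom_iff)
  then obtain l where l: "l \<in> hom (Cod A q) (Cod A g)" "l \<cdot> q = g"
    using cokernel_lift[OF assms(3,2) gh] by blast
  fix Z h assume h: "h \<in> hom Z Y" "q \<cdot> h = null Z (Cod A q)"
  have "g \<cdot> h = null Z (Cod A g)"
    unfolding l(2)[symmetric]
    using h l(1) Q(1) Obj_of_hom[OF h(1)] Obj_of_hom[OF gh]
    by (simp add: hom_iff)
  then show "\<exists>e'. e' \<in> hom Z X \<and> m \<cdot> e' = h"
    using kernel_lift[OF g gh h(1)] assms(2) by (metis hom_iff)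
qed

text \<open>The image is the kernel of the cokernel. If \<open>h\<close> kills the map \<open>e\<close> onto it, then \<open>f\<close> factors through the
  subobject \<open>ker h\<close> of the image; that subobject is itself a kernel in \<open>Y\<close> and therefore contains the kernel
  of the cokernel of \<open>f\<close>, so that \<open>ker h\<close> is everything.\<close>

lemma image_factorisation:
  assumes f: "f \<in> hom X Y" and q: "is_cokernel A f q" and m: "is_kernel A q m"
  obtains e where "e \<in> hom X (Dom A m)" "m \<cdot> e = f" "epic A e"
proof -
  note Q = cokernelD[OF q f]
  note M = kernelD[OF m Q(1)]
  obtain e where e: "e \<in> hom X (Dom A m)" "m \<cdot> e = f" using kernel_lift[OF m Q(1) f Q(2)] .
  have "epic A e"
  proof (rule epicI[OF e(1)])
    fix Z h assume h: "h \<in> hom (Dom A m) Z" "h \<cdot> e = null X Z"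
    obtain k where k: "is_kernel A h k" "k \<in> hom (Dom A k) (Dom A m)" 
      "h \<cdot> k = null (Dom A k) Z" "monic A k" using obtain_kernel[OF h(1)] by blast
    obtain e' where e': "e' \<in> hom X (Dom A k)" "k \<cdot> e' = e" using kernel_lift[OF k(1) h(1) e(1) h(2)] .
    have mk: "m \<cdot> k \<in> hom (Dom A k) Y" using M k comp_in_Hom by blast
    have "monic A (m \<cdot> k)"
    proof (rule monicI[OF mk])
      fix T g assume g: "g \<in> hom T (Dom A k)" "(m \<cdot> k) \<cdot> g = null T Y"
      have T: "T \<in> Obj A" "Dom A m \<in> Obj A" "Dom A k \<in> Obj A" using Obj_of_hom g k by blast+
      have "k \<cdot> g = null T (Dom A m)"
        by (rule monic_cancel[OF M(3,1)]) (use g k M(1) T in \<open>auto simp: hom_iff\<close>)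
      then show "g = null T (Dom A k)"
        by (rule monic_null[OF _ k(4,2)]) (use g in auto)
    qed
    obtain w where w: "is_cokernel A (m \<cdot> k) w" "w \<in> hom Y (Cod A w)" "w \<cdot> m \<cdot> k = null (Dom A k) (Cod A w)"
      using obtain_cokernel[OF mk] by blast
    have O: "X \<in> Obj A" "Cod A w \<in> Obj A" using Obj_of_hom f w(2) by blast+
    have "w \<cdot> f = (w \<cdot> m \<cdot> k) \<cdot> e'"
      using e e' M(1) k(2) w(2) by (auto simp: hom_iff)
    also have "\<dots> = null X (Cod A w)" unfolding w(3) using e' O by (auto simp: hom_iff)
    finally obtain w' where w': "w' \<in> hom (Cod A q) (Cod A w)" "w' \<cdot> q = w"
      using cokernel_lift[OF q f w(2)] by blast
    have "(w' \<cdot> q) \<cdot> m = null (Dom A m) (Cod A w)"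
      using w'(1) M(1,2) Q(1) O by (simp add: hom_iff)
    then have "w \<cdot> m = null (Dom A m) (Cod A w)" unfolding w'(2) .
    then obtain s where s: "s \<in> hom (Dom A m) (Dom A k)" "(m \<cdot> k) \<cdot> s = m"
      using kernel_lift[OF monic_is_kernel_of_cokernel[OF \<open>monic A (m \<cdot> k)\<close> mk w(1)] w(2) M(1)] mk
      by (auto simp: hom_iff)
    have "k \<cdot> s = Ide A (Dom A m)"
      by (rule monic_cancel[OF M(3,1)])
        (use s k(2) M(1) Obj_of_hom[OF e(1)] in \<open>auto simp: hom_iff\<close>)
    then have "h = (h \<cdot> k) \<cdot> s" using h(1) k(2) s(1) by (auto simp: hom_iff)
    also have "\<dots> = null (Dom A m) Z" unfolding k(3) using s Obj_of_hom[OF h(1)] by (auto simp: hom_iff)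
    finally show "h = null (Dom A m) Z" .
  qed
  then show ?thesis using that e by blast
qed

text \<open>Epimorphisms are stable under pullback; this makes generalised elements, taken up to an
  epimorphic change of their domain, behave like elements of modules. The pullback is the kernel of
  \<open>(p, - l) : X \<oplus> L \<rightarrow> Z\<close>. This map is epic, hence the cokernel of its kernel, so a morphism on \<open>L\<close>
  that vanishes on the pullback factors through it, and the factor vanishes because \<open>p\<close> is epic.\<close>

lemma lift_along_epic:
  assumes p: "p \<in> hom X Z" "epic A p" and l: "l \<in> hom L Z"
  obtains P \<pi> x where "\<pi> \<in> hom P L" "epic A \<pi>" "x \<in> hom P X" "p \<cdot> x = l \<cdot> \<pi>"
proof -
  define Y where "Y = (\<lambda>k::nat. if k = 0 then X else L)"
  have Y[simp]: "Y 0 = X" "Y (Suc 0) = L" by (auto simp: Y_def)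
  have O: "X \<in> Obj A" "L \<in> Obj A" "Z \<in> Obj A" using p l Obj_of_hom by blast+
  have "Y k \<in> Obj A" for k using O by (simp add: Y_def)
  then obtain S i where S: "is_direct_sum A 2 Y S i" using has_direct_sums[of 2 Y] by blast
  then obtain r where r: "is_biproduct 2 Y S i r" by (rule direct_sum_biproduct)
  note D = biproductD[OF r]
  have SO: "S \<in> Obj A" by (rule D(1))
  have i: "i 0 \<in> hom X S" "i 1 \<in> hom L S" using D(3)[of 0] D(3)[of 1] by auto
  have r': "r 0 \<in> hom S X" "r 1 \<in> hom S L" using D(4)[of 0] D(4)[of 1] by auto
  have ri: "r 1 \<cdot> i 0 = null X L" "r 1 \<cdot> i 1 = Ide A L"
    using D(5)[of 1 0] D(5)[of 1 1] by auto
  have ide: "i 0 \<cdot> r 0 \<oplus> i 1 \<cdot> r 1 = Ide A S"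
    using D(6) i r' SO by (simp add: numeral_2_eq_2 hom_iff)
  \<comment> \<open>\<open>n = - l\<close>\<close>
  obtain n where n: "n \<in> hom L Z" "l \<oplus> n = null L Z" using obtain_neg[OF l] .
  obtain \<phi> where \<phi>: "\<phi> \<in> hom S Z" "\<phi> \<cdot> i 0 = p" "\<phi> \<cdot> i 1 = n"
  proof (rule direct_sum_copair[OF S O(3), of "\<lambda>k. if k = 0 then p else n"])
    show "(if k = 0 then p else n) \<in> hom (Y k) Z" if "k < 2" for k
      using p n by (simp add: Y_def)
    fix h assume h: "h \<in> hom S Z" "\<And>k. k < 2 \<Longrightarrow> h \<cdot> i k = (if k = 0 then p else n)"
    show ?thesis using that[OF h(1)] h(2)[of 0] h(2)[of 1] by simp
  qed
  have "epic A \<phi>"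
  proof (rule epicI[OF \<phi>(1)])
    fix W h assume h: "h \<in> hom Z W" "h \<cdot> \<phi> = null S W"
    have W: "W \<in> Obj A" using Obj_of_hom h by blast
    have "h \<cdot> p = (h \<cdot> \<phi>) \<cdot> i 0" using h(1) \<phi> i by (auto simp: hom_iff)
    also have "\<dots> = null X W" unfolding h(2) using i W by (auto simp: hom_iff)
    finally show "h = null Z W"
      by (rule epic_null[OF _ p(2,1)]) (use h in auto)
  qed
  obtain \<kappa> where \<kappa>: "is_kernel A \<phi> \<kappa>" "\<kappa> \<in> hom (Dom A \<kappa>) S" "\<phi> \<cdot> \<kappa> = null (Dom A \<kappa>) Z" "Dom A \<kappa> \<in> Obj A"
    using obtain_kernel[OF \<phi>(1)] by blast
  let ?P = "Dom A \<kappa>" and ?\<pi> = "r 1 \<cdot> \<kappa>" and ?x = "r 0 \<cdot> \<kappa>"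
  have c: "is_cokernel A \<kappa> \<phi>" by (rule epic_is_cokernel_of_kernel[OF \<open>epic A \<phi>\<close> \<phi>(1) \<kappa>(1)])
  have \<pi>: "?\<pi> \<in> hom ?P L" and x: "?x \<in> hom ?P X" using \<kappa>(2) r' comp_in_Hom by blast+
  have "epic A ?\<pi>"
  proof (rule epicI[OF \<pi>])
    fix W h assume h: "h \<in> hom L W" "h \<cdot> ?\<pi> = null ?P W"
    have W: "W \<in> Obj A" using Obj_of_hom h by blast
    have hr: "h \<cdot> r 1 \<in> hom S W" using h r' comp_in_Hom by blast
    have "(h \<cdot> r 1) \<cdot> \<kappa> = null ?P W" using h r' \<kappa>(2) by (auto simp: hom_iff)
    then obtain h' where h': "h' \<in> hom Z W" "h' \<cdot> \<phi> = h \<cdot> r 1"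
      using cokernel_lift[OF c \<kappa>(2) hr] \<phi>(1) by (auto simp: hom_iff)
    have "h' \<cdot> p = (h' \<cdot> \<phi>) \<cdot> i 0" using h'(1) \<phi>(1,2) i by (auto simp: hom_iff)
    also have "\<dots> = null X W" unfolding h'(2) using i r' h ri W O by (auto simp: hom_iff)
    finally have "h' = null Z W"
      by (rule epic_null[OF _ p(2,1)]) (use h' in auto)
    have "h = (h \<cdot> r 1) \<cdot> i 1" using h(1) r' i ri by (auto simp: hom_iff)
    also have "\<dots> = null L W"
      unfolding h'(2)[symmetric] \<open>h' = null Z W\<close> using \<phi>(1) i W O by (auto simp: hom_iff)
    finally show "h = null L W" .
  qed
  moreover have "p \<cdot> ?x = l \<cdot> ?\<pi>"
  proof (rule add_cancel_right)
    show "n \<cdot> ?\<pi> \<in> hom ?P Z" "p \<cdot> ?x \<in> hom ?P Z" "l \<cdot> ?\<pi> \<in> hom ?P Z"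
      using comp_in_Hom \<pi> x n p l by blast+
    have "p \<cdot> ?x \<oplus> n \<cdot> ?\<pi> = \<phi> \<cdot> (i 0 \<cdot> r 0 \<oplus> i 1 \<cdot> r 1) \<cdot> \<kappa>"
      using comp_extend[OF \<phi>(2), of "r 0 \<cdot> \<kappa>"] comp_extend[OF \<phi>(3), of "r 1 \<cdot> \<kappa>"]
        \<phi>(1) i r' \<kappa>(2) by (simp add: hom_iff)
    also have "\<dots> = null ?P Z" unfolding ide using \<kappa>(2,3) by (simp add: hom_iff)
    also have "\<dots> = (l \<oplus> n) \<cdot> ?\<pi>" unfolding n(2) using \<pi> O by (simp add: hom_iff)
    also have "\<dots> = l \<cdot> ?\<pi> \<oplus> n \<cdot> ?\<pi>" 
      using comp_add_arr(2)[of ?\<pi> l n] n(1) l \<pi> by (simp add: hom_iff)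
    finally show "p \<cdot> ?x \<oplus> n \<cdot> ?\<pi> = l \<cdot> ?\<pi> \<oplus> n \<cdot> ?\<pi>" .
  qed
  ultimately show ?thesis using that \<pi> x by blast
qed

text \<open>Exactness at \<open>Y\<close> in terms of generalised elements: what the cokernel kills comes from \<open>W\<close>, after
  a cover of the domain.\<close>

lemma lift_along_cokernel:
  assumes g: "g \<in> hom W Y" "is_cokernel A g q" and y: "y \<in> hom T Y" "q \<cdot> y = null T (Cod A q)"
  obtains P \<pi> x where "\<pi> \<in> hom P T" "epic A \<pi>" "x \<in> hom P W" "g \<cdot> x = y \<cdot> \<pi>"
proof -
  note Q = cokernelD[OF g(2,1)]
  obtain m where m: "is_kernel A q m" "m \<in> hom (Dom A m) Y" using obtain_kernel[OF Q(1)] by blast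
  obtain e where e: "e \<in> hom W (Dom A m)" "m \<cdot> e = g" "epic A e"
    using image_factorisation[OF g m(1)] .
  obtain y' where y': "y' \<in> hom T (Dom A m)" "m \<cdot> y' = y" using kernel_lift[OF m(1) Q(1) y] .
  obtain P \<pi> x where P: "\<pi> \<in> hom P T" "epic A \<pi>" "x \<in> hom P W" "e \<cdot> x = y' \<cdot> \<pi>"
    using lift_along_epic[OF e(1,3) y'(1)] .
  have "g \<cdot> x = m \<cdot> e \<cdot> x" unfolding e(2)[symmetric] using P m(2) e(1) by (auto simp: hom_iff)
  also have "\<dots> = y \<cdot> \<pi>" unfolding P(4) y'(2)[symmetric] using P(1) m(2) y'(1) by (auto simp: hom_iff)
  finally show ?thesis using that P by blast
qed

lemma short_exactI_epic:
  "is_kernel A g f \<Longrightarrow> epic A g \<Longrightarrow> short_exact A f g"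
  unfolding short_exact_def using epic_is_cokernel_of_kernel[of g "Dom A g" "Cod A g" f]
  by (auto simp: is_kernel_def hom_self)

lemma short_exactI_monic:
  "is_cokernel A f g \<Longrightarrow> monic A f \<Longrightarrow> short_exact A f g"
  unfolding short_exact_def using monic_is_kernel_of_cokernel[of f "Dom A f" "Cod A f" g]
  by (auto simp: is_cokernel_def hom_self)

lemma short_exactE:
  assumes "short_exact A u p"
  obtains X' X X'' where "u \<in> hom X' X" "p \<in> hom X X''" "p \<cdot> u = null X' X''" "monic A u" "epic A p"
    "is_kernel A p u" "is_cokernel A u p"
proof -
  have k: "is_kernel A p u" "is_cokernel A u p" using assms by (auto simp: short_exact_def)
  have u: "u \<in> hom (Dom A u) (Dom A p)" and p: "p \<in> hom (Dom A p) (Cod A p)" 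
    using k(1) unfolding is_kernel_def by (auto simp: hom_iff)
  show ?thesis using that[OF u p kernelD(2)[OF k(1) p] kernelD(3)[OF k(1) p] cokernelD(3)[OF k(2) u] k] .
qed

lemma short_exactD:
  assumes "short_exact A u p" "u \<in> hom X' X" "p \<in> hom X X''"
  shows "p \<cdot> u = null X' X''" "monic A u" "epic A p" "is_kernel A p u" "is_cokernel A u p"
  using short_exactE[OF assms(1)] assms(2,3) by (metis hom_iff)+

section \<open>The two halves of the snake lemma\<close>

text \<open>For composable morphisms there is an exact sequence
  \<open>0 \<rightarrow> ker u \<rightarrow> ker (f u) \<rightarrow> ker f \<rightarrow> coker u \<rightarrow> coker (f u) \<rightarrow> coker f \<rightarrow> 0\<close>.
  The first pair of lemmas below is the case of a monomorphism \<open>u : X' \<rightarrow> X\<close> with quotient \<open>X''\<close>,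
  where the kernel and the cokernel of the middle arrow \<open>g : X'' \<rightarrow> coker (f u)\<close> describe \<open>f\<close>.
  The second pair is the dual case of a composite \<open>v f\<close> with an epimorphism \<open>v : Y \<rightarrow> Y''\<close> of
  kernel \<open>Y'\<close>, where the middle arrow is \<open>g : ker (v f) \<rightarrow> Y'\<close>.\<close>

text \<open>Both cokernels are the quotient of \<open>Y\<close> by the image of \<open>f\<close>: dividing by the image of \<open>f u\<close>
  first and by the image of the rest of \<open>X\<close> afterwards gives the same object.\<close>

lemma cokernel_of_quotient_map:
  assumes e: "short_exact A u p" "u \<in> hom X' X" "p \<in> hom X X''"
    and f: "f \<in> hom X Y" and q: "is_cokernel A (f \<cdot> u) q"
    and g: "g \<in> hom X'' (Cod A q)" "g \<cdot> p = q \<cdot> f"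
    and r: "is_cokernel A f r"
  obtains r' where "is_cokernel A g r'" "Cod A r' = Cod A r"
proof -
  note E = short_exactD[OF e]
  have fu: "f \<cdot> u \<in> hom X' Y" using f e comp_in_Hom by blast
  note Q = cokernelD[OF q fu]
  note R = cokernelD[OF r f]
  have O: "X' \<in> Obj A" "X \<in> Obj A" "X'' \<in> Obj A" "Y \<in> Obj A" "Cod A q \<in> Obj A" "Cod A r \<in> Obj A"
    using Obj_of_hom e(2,3) f Q(1) R(1) by blast+
  have "r \<cdot> f \<cdot> u = null X' (Cod A r)"
    using comp_extend[OF R(2), of u] f e(2) R(1) O by (auto simp: hom_iff)
  then obtain r' where r': "r' \<in> hom (Cod A q) (Cod A r)" "r' \<cdot> q = r"
    using cokernel_lift[OF q fu R(1)] by blast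
  have "is_cokernel A g r'"
  proof (rule cokernelI[OF g(1) r'(1)])
    show "r' \<cdot> g = null X'' (Cod A r)"
    proof (rule epic_cancel[OF E(3) e(3)])
      have "(r' \<cdot> g) \<cdot> p = (r' \<cdot> q) \<cdot> f" using g r'(1) e(3) Q(1) f by (simp add: hom_iff)
      also have "\<dots> = null X'' (Cod A r) \<cdot> p" 
        unfolding r'(2) R(2) using e(3) O by (auto simp: hom_iff)
      finally show "(r' \<cdot> g) \<cdot> p = null X'' (Cod A r) \<cdot> p" .
    qed (use g r' null_in_hom comp_in_Hom O in auto)
    show "epic A r'"
    proof (rule epicI[OF r'(1)])
      fix Z h assume h: "h \<in> hom (Cod A r) Z" "h \<cdot> r' = null (Cod A q) Z"
      have Z: "Z \<in> Obj A" using Obj_of_hom h by blast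
      have "h \<cdot> r = (h \<cdot> r') \<cdot> q" using h(1) r' Q(1) by (auto simp: hom_iff)
      also have "\<dots> = null Y Z" unfolding h(2) using Q(1) Z by (auto simp: hom_iff)
      finally show "h = null (Cod A r) Z"
        by (rule epic_null[OF _ R(3,1)]) (use h in auto)
    qed
    fix Z h assume h: "h \<in> hom (Cod A q) Z" "h \<cdot> g = null X'' Z"
    have Z: "Z \<in> Obj A" using Obj_of_hom h by blast
    have hq: "h \<cdot> q \<in> hom Y Z" using h Q(1) comp_in_Hom by blast
    have "(h \<cdot> q) \<cdot> f = (h \<cdot> g) \<cdot> p" using h(1) g e(3) Q(1) f by (auto simp: hom_iff)
    also have "\<dots> = null X Z" unfolding h(2) using e(3) Z by (auto simp: hom_iff)
    finally obtain h' where h': "h' \<in> hom (Cod A r) Z" "h' \<cdot> r = h \<cdot> q"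
      using cokernel_lift[OF r f hq] by blast
    have "h' \<cdot> r' = h"
    proof (rule epic_cancel[OF Q(3,1)])
      show "(h' \<cdot> r') \<cdot> q = h \<cdot> q" using h' r' Q(1) by (auto simp: hom_iff)
    qed (use h h' r' comp_in_Hom in auto)
    then show "\<exists>h'. h' \<in> hom (Cod A r) Z \<and> h' \<cdot> r' = h" using h' by blast
  qed
  then show ?thesis using that r' by (auto simp: hom_iff)
qed

text \<open>The claim with content is that \<open>ker f \<rightarrow> ker g\<close> is epic. Chasing a generalised element: an
  element \<open>l\<close> of \<open>ker g\<close> lifts to some \<open>x\<close> in \<open>X\<close>; as \<open>f x\<close> vanishes in the cokernel of \<open>f u\<close>, it
  equals \<open>f (u x')\<close> for some \<open>x'\<close>, and \<open>x - u x'\<close> is an element of \<open>ker f\<close> over \<open>l\<close>. Each lift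
  exists only after passing to a cover of the domain by an epimorphism, which is harmless because
  \<open>b w\<close> epic implies \<open>b\<close> epic.\<close>

lemma kernel_short_exact:
  assumes e: "short_exact A u p" "u \<in> hom X' X" "p \<in> hom X X''"
    and f: "f \<in> hom X Y" and k': "is_kernel A (f \<cdot> u) k'" and q: "is_cokernel A (f \<cdot> u) q"
    and g: "g \<in> hom X'' (Cod A q)" "g \<cdot> p = q \<cdot> f"
    and k: "is_kernel A f k" and l: "is_kernel A g l"
  obtains a b where "short_exact A a b" "a \<in> hom (Dom A k') (Dom A k)" "b \<in> hom (Dom A k) (Dom A l)"
proof -
  note E = short_exactD[OF e]
  have fu: "f \<cdot> u \<in> hom X' Y" using f e comp_in_Hom by blast
  note Q = cokernelD[OF q fu]
  note K' = kernelD[OF k' fu]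
  note K = kernelD[OF k f]
  note L = kernelD[OF l g(1)]
  have O: "X' \<in> Obj A" "X \<in> Obj A" "X'' \<in> Obj A" "Y \<in> Obj A" "Cod A q \<in> Obj A" 
    "Dom A k' \<in> Obj A" "Dom A k \<in> Obj A" "Dom A l \<in> Obj A"
    using Obj_of_hom e(2,3) f Q(1) K'(1) K(1) L(1) by blast+
  have uk: "u \<cdot> k' \<in> hom (Dom A k') X" using e K' comp_in_Hom by blast
  have "f \<cdot> u \<cdot> k' = null (Dom A k') Y" using K'(1,2) f e(2) by (auto simp: hom_iff)
  then obtain a where a: "a \<in> hom (Dom A k') (Dom A k)" "k \<cdot> a = u \<cdot> k'" 
    using kernel_lift[OF k f uk] by blast
  have pk: "p \<cdot> k \<in> hom (Dom A k) X''" using e K comp_in_Hom by blast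
  have "g \<cdot> p \<cdot> k = (g \<cdot> p) \<cdot> k" using g(1) e(3) K(1) by (auto simp: hom_iff)
  also have "\<dots> = null (Dom A k) (Cod A q)"
    unfolding g(2) using Q(1) f K(1,2) O by (auto simp: hom_iff)
  finally obtain b where b: "b \<in> hom (Dom A k) (Dom A l)" "l \<cdot> b = p \<cdot> k"
    using kernel_lift[OF l g(1) pk] by blast
  have ker: "is_kernel A b a"
  proof (rule kernelI[OF b(1) a(1)])
    show "b \<cdot> a = null (Dom A k') (Dom A l)"
    proof (rule monic_cancel[OF L(3,1)])
      have "l \<cdot> b \<cdot> a = (l \<cdot> b) \<cdot> a" using b(1) a(1) L(1) by (auto simp: hom_iff)
      also have "\<dots> = p \<cdot> u \<cdot> k'" unfolding b(2) using K(1) e(3) a by (auto simp: hom_iff)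
      also have "\<dots> = null (Dom A k') X''"
        using comp_extend[OF E(1), of k'] e(2,3) K'(1) O by (auto simp: hom_iff)
      also have "\<dots> = l \<cdot> null (Dom A k') (Dom A l)" using L(1) O by (auto simp: hom_iff)
      finally show "l \<cdot> b \<cdot> a = l \<cdot> null (Dom A k') (Dom A l)" .
    qed (use a b O null_in_hom comp_in_Hom in auto)
    show "monic A a"
    proof (rule monicI[OF a(1)])
      fix Z h assume h: "h \<in> hom Z (Dom A k')" "a \<cdot> h = null Z (Dom A k)"
      have Z: "Z \<in> Obj A" using Obj_of_hom h by blast
      have "u \<cdot> k' \<cdot> h = null Z X" 
        using comp_extend[OF a(2), of h] a(1) h K(1) K'(1) e(2) Z by (auto simp: hom_iff)
      then have "k' \<cdot> h = null Z X'"
        by (rule monic_null[OF _ E(2) e(2)]) (use h K'(1) comp_in_Hom in blast)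
      then show "h = null Z (Dom A k')"
        by (rule monic_null[OF _ K'(3,1)]) (use h in auto)
    qed
    fix Z h assume h: "h \<in> hom Z (Dom A k)" "b \<cdot> h = null Z (Dom A l)"
    have Z: "Z \<in> Obj A" using Obj_of_hom h by blast
    have kh: "k \<cdot> h \<in> hom Z X" using h K comp_in_Hom by blast
    have "p \<cdot> k \<cdot> h = null Z X''"
      using comp_extend[OF b(2), of h] b(1) h K(1) L(1) e(3) Z by (auto simp: hom_iff)
    then obtain x where x: "x \<in> hom Z X'" "u \<cdot> x = k \<cdot> h"
      using kernel_lift[OF E(4) e(3) kh] e(2) by (auto simp: hom_iff)
    have "(f \<cdot> u) \<cdot> x = (f \<cdot> k) \<cdot> h" using f e(2) x h K(1) by (auto simp: hom_iff)
    also have "\<dots> = null Z Y" unfolding K(2) using h O by (auto simp: hom_iff)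
    finally obtain x' where x': "x' \<in> hom Z (Dom A k')" "k' \<cdot> x' = x"
      using kernel_lift[OF k' fu x(1)] by blast
    have "a \<cdot> x' = h"
      by (rule monic_cancel[OF K(3,1)])
        (use x x' a h comp_extend[OF a(2), of x'] K(1) K'(1) e(2) in \<open>auto simp: hom_iff\<close>)
    then show "\<exists>x'. x' \<in> hom Z (Dom A k') \<and> a \<cdot> x' = h" using x' by blast
  qed
  have "epic A b"
  proof -
    obtain P \<pi> x where P: "\<pi> \<in> hom P (Dom A l)" "epic A \<pi>" "x \<in> hom P X" "p \<cdot> x = l \<cdot> \<pi>"
      using lift_along_epic[OF e(3) E(3) L(1)] .
    have PO: "P \<in> Obj A" using Obj_of_hom P by blast
    have fx: "f \<cdot> x \<in> hom P Y" using f P comp_in_Hom by blast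
    have "q \<cdot> f \<cdot> x = (g \<cdot> p) \<cdot> x" unfolding g(2) using Q(1) f P(3) by (auto simp: hom_iff)
    also have "\<dots> = (g \<cdot> l) \<cdot> \<pi>" using P g(1) e(3) L(1) by (auto simp: hom_iff)
    also have "\<dots> = null P (Cod A q)" unfolding L(2) using P O by (auto simp: hom_iff)
    finally obtain P' \<pi>' x' where P': "\<pi>' \<in> hom P' P" "epic A \<pi>'" "x' \<in> hom P' X'"
      "(f \<cdot> u) \<cdot> x' = (f \<cdot> x) \<cdot> \<pi>'"
      using lift_along_cokernel[OF fu q fx] by blast
    have PO': "P' \<in> Obj A" using Obj_of_hom P' by blast
    \<comment> \<open>\<open>n = - x'\<close>, so \<open>?z\<close> is the element \<open>x - u x'\<close> of the kernel of \<open>f\<close>\<close>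
    obtain n where n: "n \<in> hom P' X'" "x' \<oplus> n = null P' X'" using obtain_neg[OF P'(3)] .
    let ?z = "x \<cdot> \<pi>' \<oplus> u \<cdot> n"
    have z: "?z \<in> hom P' X" using add_in_hom comp_in_Hom n P P' e by blast
    have "f \<cdot> ?z = (f \<cdot> u) \<cdot> x' \<oplus> (f \<cdot> u) \<cdot> n"
      unfolding P'(4) using f P(3) P'(1) n(1) e(2) by (simp add: hom_iff)
    also have "\<dots> = (f \<cdot> u) \<cdot> (x' \<oplus> n)"
      using comp_add_arr(1)[of x' n "f \<cdot> u"] P'(3) n(1) fu by (simp add: hom_iff)
    also have "\<dots> = null P' Y" unfolding n(2) using fu PO' O by (auto simp: hom_iff)
    finally obtain w where w: "w \<in> hom P' (Dom A k)" "k \<cdot> w = ?z"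
      using kernel_lift[OF k f z] by blast
    have "p \<cdot> ?z = (p \<cdot> x) \<cdot> \<pi>' \<oplus> (p \<cdot> u) \<cdot> n"
      using P(3) P'(1) n(1) e(2,3) by (simp add: hom_iff)
    also have "\<dots> = l \<cdot> \<pi> \<cdot> \<pi>'"
      unfolding E(1) P(4) using P(1) P'(1) n(1) L(1) O PO' by (simp add: hom_iff)
    finally have pz: "p \<cdot> ?z = l \<cdot> \<pi> \<cdot> \<pi>'" .
    have "b \<cdot> w = \<pi> \<cdot> \<pi>'"
    proof (rule monic_cancel[OF L(3,1) comp_in_Hom[OF w(1) b(1)] comp_in_Hom[OF P'(1) P(1)]])
      have "l \<cdot> b \<cdot> w = (l \<cdot> b) \<cdot> w" using b(1) w(1) L(1) by (auto simp: hom_iff)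
      also have "\<dots> = p \<cdot> k \<cdot> w" unfolding b(2) using K(1) e(3) w(1) by (auto simp: hom_iff)
      finally show "l \<cdot> b \<cdot> w = l \<cdot> \<pi> \<cdot> \<pi>'" unfolding w(2) pz .
    qed
    moreover have "epic A (\<pi> \<cdot> \<pi>')" using epic_comp P P' by (auto simp: hom_iff)
    ultimately have bw: "epic A (b \<cdot> w)" by simp
    show ?thesis
    proof (rule epicI[OF b(1)])
      fix Z h assume h: "h \<in> hom (Dom A l) Z" "h \<cdot> b = null (Dom A k) Z"
      have Z: "Z \<in> Obj A" using Obj_of_hom h by blast
      have "h \<cdot> b \<cdot> w = null P' Z"
        using comp_extend[OF h(2), of w] h(1) b(1) w(1) Z by (auto simp: hom_iff)
      then show "h = null (Dom A l) Z"
        by (rule epic_null[OF _ bw]) (use h comp_in_Hom[OF w(1) b(1)] in auto)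
    qed
  qed
  then show ?thesis using that[OF short_exactI_epic[OF ker] a(1) b(1)] by blast
qed

text \<open>The kernel of \<open>f\<close> already lies in the preimage \<open>ker (v f)\<close> of \<open>Y'\<close>, and \<open>f\<close> restricted to
  that preimage is \<open>g\<close> followed by a monomorphism.\<close>

lemma kernel_of_corestriction:
  assumes e: "short_exact A u v" "u \<in> hom Y' Y" "v \<in> hom Y Y''"
    and f: "f \<in> hom X Y" and k: "is_kernel A (v \<cdot> f) k"
    and g: "g \<in> hom (Dom A k) Y'" "u \<cdot> g = f \<cdot> k"
    and s: "is_kernel A f s"
  obtains s' where "is_kernel A g s'" "Dom A s' = Dom A s"
proof -
  note E = short_exactD[OF e]
  have vf: "v \<cdot> f \<in> hom X Y''" using f e comp_in_Hom by blast
  note K = kernelD[OF k vf]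
  note S = kernelD[OF s f]
  have O: "X \<in> Obj A" "Y' \<in> Obj A" "Y \<in> Obj A" "Y'' \<in> Obj A" "Dom A k \<in> Obj A" "Dom A s \<in> Obj A"
    using Obj_of_hom e(2,3) f K(1) S(1) by blast+
  have "(v \<cdot> f) \<cdot> s = null (Dom A s) Y''"
    using S(1,2) f e(3) O by (auto simp: hom_iff)
  then obtain s' where s': "s' \<in> hom (Dom A s) (Dom A k)" "k \<cdot> s' = s"
    using kernel_lift[OF k vf S(1)] by blast
  have fk: "f \<cdot> k \<cdot> x = u \<cdot> g \<cdot> x" if "x \<in> hom Z (Dom A k)" for x Z
    using comp_extend[OF g(2), of x] that g(1) e(2) f K(1) by (auto simp: hom_iff)
  have "is_kernel A g s'"
  proof (rule kernelI[OF g(1) s'(1)])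
    have "u \<cdot> g \<cdot> s' = null (Dom A s) Y" unfolding fk[OF s'(1), symmetric] s'(2) by (rule S(2))
    then show "g \<cdot> s' = null (Dom A s) Y'"
      by (rule monic_null[OF _ E(2) e(2)]) (use comp_in_Hom[OF s'(1) g(1)] in auto)
    show "monic A s'"
    proof (rule monicI[OF s'(1)])
      fix Z h assume h: "h \<in> hom Z (Dom A s)" "s' \<cdot> h = null Z (Dom A k)"
      have Z: "Z \<in> Obj A" using Obj_of_hom h by blast
      have "s \<cdot> h = k \<cdot> s' \<cdot> h" 
        using comp_extend[OF s'(2), of h] h(1) s'(1) K(1) by (simp add: hom_iff)
      also have "\<dots> = null Z X" unfolding h(2) using K(1) Z O by (auto simp: hom_iff)
      finally show "h = null Z (Dom A s)"
        by (rule monic_null[OF _ S(3,1)]) (use h in auto)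
    qed
    fix Z h assume h: "h \<in> hom Z (Dom A k)" "g \<cdot> h = null Z Y'"
    have Z: "Z \<in> Obj A" using Obj_of_hom h by blast
    have kh: "k \<cdot> h \<in> hom Z X" using h K(1) comp_in_Hom by blast
    have "f \<cdot> k \<cdot> h = null Z Y" unfolding fk[OF h(1)] h(2) using e(2) Z by (auto simp: hom_iff)
    then obtain h' where h': "h' \<in> hom Z (Dom A s)" "s \<cdot> h' = k \<cdot> h"
      using kernel_lift[OF s f kh] by blast
    have "s' \<cdot> h' = h"
    proof (rule monic_cancel[OF K(3,1) comp_in_Hom[OF h'(1) s'(1)] h(1)])
      show "k \<cdot> s' \<cdot> h' = k \<cdot> h"
        using comp_extend[OF s'(2), of h'] h' s'(1) K(1) by (simp add: hom_iff)
    qed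
    then show "\<exists>h'. h' \<in> hom Z (Dom A s) \<and> s' \<cdot> h' = h" using h' by blast
  qed
  then show ?thesis using that s' by (auto simp: hom_iff)
qed

text \<open>Here the claim with content is that \<open>coker g \<rightarrow> coker f\<close> is monic: if \<open>y\<close> in \<open>Y'\<close> becomes
  zero in \<open>coker f\<close>, then \<open>u y = f x\<close> for some \<open>x\<close>, which satisfies \<open>v f x = v u y = 0\<close>, so that
  \<open>x\<close> lies in \<open>ker (v f)\<close> and \<open>y\<close> is in the image of \<open>g\<close>.\<close>

lemma cokernel_short_exact:
  assumes e: "short_exact A u v" "u \<in> hom Y' Y" "v \<in> hom Y Y''"
    and f: "f \<in> hom X Y" and k: "is_kernel A (v \<cdot> f) k" and q: "is_cokernel A (v \<cdot> f) q"
    and g: "g \<in> hom (Dom A k) Y'" "u \<cdot> g = f \<cdot> k"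
    and r: "is_cokernel A f r" and c: "is_cokernel A g c"
  obtains a b where "short_exact A a b" "a \<in> hom (Cod A c) (Cod A r)" "b \<in> hom (Cod A r) (Cod A q)"
proof -
  note E = short_exactD[OF e]
  have vf: "v \<cdot> f \<in> hom X Y''" using f e comp_in_Hom by blast
  note K = kernelD[OF k vf]
  note Q = cokernelD[OF q vf]
  note R = cokernelD[OF r f]
  note C = cokernelD[OF c g(1)]
  have O: "X \<in> Obj A" "Y' \<in> Obj A" "Y \<in> Obj A" "Y'' \<in> Obj A" "Dom A k \<in> Obj A"
    "Cod A q \<in> Obj A" "Cod A r \<in> Obj A" "Cod A c \<in> Obj A"
    using Obj_of_hom e(2,3) f K(1) Q(1) R(1) C(1) by blast+
  have fk: "f \<cdot> k \<cdot> x = u \<cdot> g \<cdot> x" if "x \<in> hom Z (Dom A k)" for x Z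
    using comp_extend[OF g(2), of x] that g(1) e(2) f K(1) by (auto simp: hom_iff)
  have ru: "r \<cdot> u \<in> hom Y' (Cod A r)" using R(1) e comp_in_Hom by blast
  have "(r \<cdot> u) \<cdot> g = (r \<cdot> f) \<cdot> k" using R(1) e(2) f g K(1) by (simp add: hom_iff)
  also have "\<dots> = null (Dom A k) (Cod A r)" unfolding R(2) using K(1) O by (auto simp: hom_iff)
  finally obtain a where a: "a \<in> hom (Cod A c) (Cod A r)" "a \<cdot> c = r \<cdot> u"
    using cokernel_lift[OF c g(1) ru] by blast
  have qv: "q \<cdot> v \<in> hom Y (Cod A q)" using e Q comp_in_Hom by blast
  have "(q \<cdot> v) \<cdot> f = null X (Cod A q)" using Q(1,2) e(3) f by (auto simp: hom_iff)
  then obtain b where b: "b \<in> hom (Cod A r) (Cod A q)" "b \<cdot> r = q \<cdot> v"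
    using cokernel_lift[OF r f qv] by blast
  have coker: "is_cokernel A a b"
  proof (rule cokernelI[OF a(1) b(1)])
    show "b \<cdot> a = null (Cod A c) (Cod A q)"
    proof (rule epic_null[OF _ C(3,1) comp_in_Hom[OF a(1) b(1)]])
      have "(b \<cdot> a) \<cdot> c = b \<cdot> r \<cdot> u" using a b(1) C(1) by (simp add: hom_iff)
      also have "\<dots> = q \<cdot> v \<cdot> u"
        using comp_extend[OF b(2), of u] b(1) R(1) Q(1) e(2,3) by (simp add: hom_iff)
      also have "\<dots> = null Y' (Cod A q)" unfolding E(1) using Q(1) O by (auto simp: hom_iff)
      finally show "(b \<cdot> a) \<cdot> c = null Y' (Cod A q)" .
    qed
    show "epic A b"
    proof (rule epicI[OF b(1)])
      fix Z h assume h: "h \<in> hom (Cod A q) Z" "h \<cdot> b = null (Cod A r) Z"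
      have Z: "Z \<in> Obj A" using Obj_of_hom h by blast
      have "(h \<cdot> q) \<cdot> v = (h \<cdot> b) \<cdot> r" using h(1) b Q(1) e(3) R(1) by (simp add: hom_iff)
      also have "\<dots> = null Y Z" unfolding h(2) using R(1) Z by (auto simp: hom_iff)
      finally have "h \<cdot> q = null Y'' Z"
        by (rule epic_null[OF _ E(3) e(3)]) (use comp_in_Hom[OF Q(1) h(1)] in auto)
      then show "h = null (Cod A q) Z"
        by (rule epic_null[OF _ Q(3,1)]) (use h in auto)
    qed
    fix Z h assume h: "h \<in> hom (Cod A r) Z" "h \<cdot> a = null (Cod A c) Z"
    have Z: "Z \<in> Obj A" using Obj_of_hom h by blast
    have hr: "h \<cdot> r \<in> hom Y Z" using h R comp_in_Hom by blast
    have "(h \<cdot> r) \<cdot> u = (h \<cdot> a) \<cdot> c" using h(1) a R(1) C(1) e(2) by (simp add: hom_iff)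
    also have "\<dots> = null Y' Z" unfolding h(2) using C(1) Z by (auto simp: hom_iff)
    finally obtain x where x: "x \<in> hom Y'' Z" "x \<cdot> v = h \<cdot> r"
      using cokernel_lift[OF E(5) e(2) hr] e(3) by (auto simp: hom_iff)
    have "x \<cdot> v \<cdot> f = h \<cdot> r \<cdot> f"
      using comp_extend[OF x(2), of f] x(1) h(1) e(3) R(1) f by (simp add: hom_iff)
    also have "\<dots> = null X Z" unfolding R(2) using h O by (auto simp: hom_iff)
    finally obtain x' where x': "x' \<in> hom (Cod A q) Z" "x' \<cdot> q = x"
      using cokernel_lift[OF q vf x(1)] by blast
    have "x' \<cdot> b = h"
    proof (rule epic_cancel[OF R(3,1) comp_in_Hom[OF b(1) x'(1)] h(1)])
      have "(x' \<cdot> b) \<cdot> r = (x' \<cdot> q) \<cdot> v" using x'(1) b R(1) Q(1) e(3) by (simp add: hom_iff)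
      then show "(x' \<cdot> b) \<cdot> r = h \<cdot> r" unfolding x'(2) x(2) .
    qed
    then show "\<exists>x'. x' \<in> hom (Cod A q) Z \<and> x' \<cdot> b = h" using x' by blast
  qed
  have "monic A a"
  proof (rule monicI[OF a(1)])
    fix T t assume t: "t \<in> hom T (Cod A c)" "a \<cdot> t = null T (Cod A r)"
    have T: "T \<in> Obj A" using Obj_of_hom t by blast
    obtain P \<pi> y where P: "\<pi> \<in> hom P T" "epic A \<pi>" "y \<in> hom P Y'" "c \<cdot> y = t \<cdot> \<pi>"
      using lift_along_epic[OF C(1,3) t(1)] .
    have uy: "u \<cdot> y \<in> hom P Y" using e P comp_in_Hom by blast
    have PO: "P \<in> Obj A" using Obj_of_hom P by blast
    have "r \<cdot> u \<cdot> y = (a \<cdot> c) \<cdot> y" unfolding a(2) using R(1) e(2) P(3) by (simp add: hom_iff)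
    also have "\<dots> = (a \<cdot> t) \<cdot> \<pi>" using a(1) C(1) P t(1) by (simp add: hom_iff)
    also have "\<dots> = null P (Cod A r)" unfolding t(2) using P(1) O by (auto simp: hom_iff)
    finally obtain P' \<pi>' x where P': "\<pi>' \<in> hom P' P" "epic A \<pi>'" "x \<in> hom P' X" "f \<cdot> x = (u \<cdot> y) \<cdot> \<pi>'"
      using lift_along_cokernel[OF f r uy] by blast
    have PO': "P' \<in> Obj A" using Obj_of_hom P' by blast
    have "(v \<cdot> f) \<cdot> x = v \<cdot> f \<cdot> x" using e(3) f P'(3) by (simp add: hom_iff)
    also have "\<dots> = (v \<cdot> u) \<cdot> y \<cdot> \<pi>'" unfolding P'(4) using e(2,3) P(3) P'(1) by (simp add: hom_iff)
    also have "\<dots> = null P' Y''"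
      unfolding E(1) using comp_in_Hom[OF P'(1) P(3)] O by (auto simp: hom_iff)
    finally obtain x' where x': "x' \<in> hom P' (Dom A k)" "k \<cdot> x' = x"
      using kernel_lift[OF k vf P'(3)] by blast
    have "g \<cdot> x' = y \<cdot> \<pi>'"
    proof (rule monic_cancel[OF E(2) e(2) comp_in_Hom[OF x'(1) g(1)] comp_in_Hom[OF P'(1) P(3)]])
      show "u \<cdot> g \<cdot> x' = u \<cdot> y \<cdot> \<pi>'"
        unfolding fk[OF x'(1), symmetric] x'(2) P'(4) using e(2) P(3) P'(1) by (simp add: hom_iff)
    qed
    have "t \<cdot> \<pi> \<cdot> \<pi>' = (c \<cdot> y) \<cdot> \<pi>'" unfolding P(4) using t(1) P(1) P'(1) by (simp add: hom_iff)
    also have "\<dots> = c \<cdot> y \<cdot> \<pi>'" using C(1) P(3) P'(1) by (simp add: hom_iff)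
    also have "\<dots> = (c \<cdot> g) \<cdot> x'" 
      unfolding \<open>g \<cdot> x' = y \<cdot> \<pi>'\<close>[symmetric] using C(1) g(1) x'(1) by (simp add: hom_iff)
    also have "\<dots> = null P' (Cod A c)" unfolding C(2) using x'(1) O by (auto simp: hom_iff)
    finally show "t = null T (Cod A c)"
      by (rule epic_null[OF _ epic_comp[OF P'(2) P(2)] comp_in_Hom[OF P'(1) P(1)]])
        (use t P P' in \<open>auto simp: hom_iff\<close>)
  qed
  then show ?thesis using that[OF short_exactI_monic[OF coker] a(1) b(1)] by blast
qed

section \<open>Isomorphisms and zero objects\<close>

text \<open>Kernels and cokernels are determined up to isomorphism only. The next four lemmas allow the ends of a
  (co)kernel diagram to be replaced by isomorphic objects.\<close>

lemma kernel_precomp_iso: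
  assumes "is_kernel A f k" "f \<in> hom X Y"
    and a: "a \<in> hom X' X" "b \<in> hom X X'" "b \<cdot> a = Ide A X'" "a \<cdot> b = Ide A X"
  shows "is_kernel A (f \<cdot> a) (b \<cdot> k)"
proof (rule kernelI[OF comp_in_Hom[OF a(1) assms(2)]])
  note K = kernelD[OF assms(1,2)]
  show bk: "b \<cdot> k \<in> hom (Dom A k) X'" using K a comp_in_Hom by blast
  show "(f \<cdot> a) \<cdot> b \<cdot> k = null (Dom A k) Y"
    using comp_extend[OF a(4), of k] K(1,2) a(1,2) assms(2) by (simp add: hom_iff)
  show "monic A (b \<cdot> k)"
  proof (rule monicI[OF bk])
    fix Z h assume h: "h \<in> hom Z (Dom A k)" "(b \<cdot> k) \<cdot> h = null Z X'"
    have Z: "Z \<in> Obj A" using Obj_of_hom h by blast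
    have "k \<cdot> h = a \<cdot> (b \<cdot> k) \<cdot> h"
      using comp_extend[OF a(4), of "k \<cdot> h"] K(1) h(1) a(1,2) by (simp add: hom_iff)
    also have "\<dots> = null Z X" unfolding h(2) using a(1) Z by (auto simp: hom_iff)
    finally show "h = null Z (Dom A k)" by (rule monic_null[OF _ K(3,1) h(1)])
  qed
  fix Z g assume g: "g \<in> hom Z X'" "(f \<cdot> a) \<cdot> g = null Z Y"
  have "f \<cdot> a \<cdot> g = null Z Y" using g assms(2) a(1) by (simp add: hom_iff)
  then obtain h where h: "h \<in> hom Z (Dom A k)" "k \<cdot> h = a \<cdot> g"
    using kernel_lift[OF assms(1,2) comp_in_Hom[OF g(1) a(1)]] by blast
  have "(b \<cdot> k) \<cdot> h = b \<cdot> k \<cdot> h" using h(1) K(1) a(2) by (simp add: hom_iff)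
  also have "\<dots> = g" 
    unfolding h(2) using comp_extend[OF a(3), of g] g(1) a(1,2) by (simp add: hom_iff)
  finally show "\<exists>h. h \<in> hom Z (Dom A k) \<and> (b \<cdot> k) \<cdot> h = g" using h by blast
qed

lemma cokernel_postcomp_iso:
  assumes "is_cokernel A f q" "f \<in> hom X Y"
    and a: "a \<in> hom Y Y'" "b \<in> hom Y' Y" "b \<cdot> a = Ide A Y" "a \<cdot> b = Ide A Y'"
  shows "is_cokernel A (a \<cdot> f) (q \<cdot> b)"
proof (rule cokernelI[OF comp_in_Hom[OF assms(2) a(1)]])
  note Q = cokernelD[OF assms(1,2)]
  show qb: "q \<cdot> b \<in> hom Y' (Cod A q)" using Q a comp_in_Hom by blast
  show "(q \<cdot> b) \<cdot> a \<cdot> f = null X (Cod A q)"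
    using comp_extend[OF a(3), of f] Q(1,2) a(1,2) assms(2) by (simp add: hom_iff)
  show "epic A (q \<cdot> b)"
  proof (rule epicI[OF qb])
    fix Z h assume h: "h \<in> hom (Cod A q) Z" "h \<cdot> q \<cdot> b = null Y' Z"
    have Z: "Z \<in> Obj A" using Obj_of_hom h by blast
    have "h \<cdot> q = (h \<cdot> q \<cdot> b) \<cdot> a" using a Q(1) h(1) by (simp add: hom_iff)
    also have "\<dots> = null Y Z" unfolding h(2) using a(1) Z by (auto simp: hom_iff)
    finally show "h = null (Cod A q) Z" by (rule epic_null[OF _ Q(3,1) h(1)])
  qed
  fix Z g assume g: "g \<in> hom Y' Z" "g \<cdot> a \<cdot> f = null X Z"
  have "(g \<cdot> a) \<cdot> f = null X Z" using g assms(2) a(1) by (simp add: hom_iff)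
  then obtain h where h: "h \<in> hom (Cod A q) Z" "h \<cdot> q = g \<cdot> a"
    using cokernel_lift[OF assms(1,2) comp_in_Hom[OF a(1) g(1)]] by blast
  have "h \<cdot> q \<cdot> b = (h \<cdot> q) \<cdot> b" using h(1) Q(1) a(2) by (simp add: hom_iff)
  also have "\<dots> = g" unfolding h(2) using g(1) a by (simp add: hom_iff)
  finally show "\<exists>h. h \<in> hom (Cod A q) Z \<and> h \<cdot> q \<cdot> b = g" using h by blast
qed

lemma kernel_iso:
  assumes "is_kernel A f k" "f \<in> hom X Y"
    and a: "a \<in> hom K (Dom A k)" "b \<in> hom (Dom A k) K" "b \<cdot> a = Ide A K" "a \<cdot> b = Ide A (Dom A k)"
  shows "is_kernel A f (k \<cdot> a)"
proof (rule kernelI[OF assms(2)])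
  note K = kernelD[OF assms(1,2)]
  have Y: "Y \<in> Obj A" using Obj_of_hom assms(2) by blast
  show ka: "k \<cdot> a \<in> hom K X" using K a comp_in_Hom by blast
  show "f \<cdot> k \<cdot> a = null K Y"
    using comp_extend[OF K(2), of a] K(1) a(1) assms(2) Y by (simp add: hom_iff)
  show "monic A (k \<cdot> a)"
  proof (rule monicI[OF ka])
    fix Z h assume h: "h \<in> hom Z K" "(k \<cdot> a) \<cdot> h = null Z X"
    have Z: "Z \<in> Obj A" using Obj_of_hom h by blast
    have "k \<cdot> a \<cdot> h = null Z X" using h K(1) a(1) by (simp add: hom_iff)
    then have "a \<cdot> h = null Z (Dom A k)" by (rule monic_null[OF _ K(3,1) comp_in_Hom[OF h(1) a(1)]])
    then have "b \<cdot> a \<cdot> h = null Z K" using a(2) Z by (auto simp: hom_iff)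
    then show "h = null Z K" using comp_extend[OF a(3), of h] a(1,2) h(1) by (simp add: hom_iff)
  qed
  fix Z g assume g: "g \<in> hom Z X" "f \<cdot> g = null Z Y"
  obtain h where h: "h \<in> hom Z (Dom A k)" "k \<cdot> h = g"
    using kernel_lift[OF assms(1,2) g] by blast
  have "(k \<cdot> a) \<cdot> b \<cdot> h = g"
    using comp_extend[OF a(4), of h] h a(1,2) K(1) by (simp add: hom_iff)
  then show "\<exists>h. h \<in> hom Z K \<and> (k \<cdot> a) \<cdot> h = g" using comp_in_Hom[OF h(1) a(2)] by blast
qed

lemma cokernel_iso:
  assumes "is_cokernel A f q" "f \<in> hom X Y"
    and a: "a \<in> hom (Cod A q) Q" "b \<in> hom Q (Cod A q)" "b \<cdot> a = Ide A (Cod A q)" "a \<cdot> b = Ide A Q"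
  shows "is_cokernel A f (a \<cdot> q)"
proof (rule cokernelI[OF assms(2)])
  note Q = cokernelD[OF assms(1,2)]
  have X: "X \<in> Obj A" using Obj_of_hom assms(2) by blast
  show aq: "a \<cdot> q \<in> hom Y Q" using Q a comp_in_Hom by blast
  show "(a \<cdot> q) \<cdot> f = null X Q"
    using Q(1,2) a(1) assms(2) X by (simp add: hom_iff)
  show "epic A (a \<cdot> q)"
  proof (rule epicI[OF aq])
    fix Z h assume h: "h \<in> hom Q Z" "h \<cdot> a \<cdot> q = null Y Z"
    have Z: "Z \<in> Obj A" using Obj_of_hom h by blast
    have "(h \<cdot> a) \<cdot> q = null Y Z" using h Q(1) a(1) by (simp add: hom_iff)
    then have "h \<cdot> a = null (Cod A q) Z" by (rule epic_null[OF _ Q(3,1) comp_in_Hom[OF a(1) h(1)]])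
    then have "(h \<cdot> a) \<cdot> b = null Q Z" using a(2) Z by (auto simp: hom_iff)
    then show "h = null Q Z" using a h(1) by (simp add: hom_iff)
  qed
  fix Z g assume g: "g \<in> hom Y Z" "g \<cdot> f = null X Z"
  obtain h where h: "h \<in> hom (Cod A q) Z" "h \<cdot> q = g"
    using cokernel_lift[OF assms(1,2) g] by blast
  have "(h \<cdot> b) \<cdot> a \<cdot> q = g"
    using comp_extend[OF a(3), of q] h a(1,2) Q(1) by (simp add: hom_iff)
  then show "\<exists>h. h \<in> hom Q Z \<and> h \<cdot> a \<cdot> q = g" using comp_in_Hom[OF a(2) h(1)] by blast
qed

lemma zero_object_iff:
  "zero_object A X \<longleftrightarrow> X \<in> Obj A \<and> Ide A X = null X X"
proof
  assume "zero_object A X"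
  then have X: "X \<in> Obj A" "\<exists>!f. f \<in> hom X X" unfolding zero_object_def by auto
  then show "X \<in> Obj A \<and> Ide A X = null X X" using ide_in_Hom null_in_hom by blast
next
  assume X: "X \<in> Obj A \<and> Ide A X = null X X"
  have 1: "f = null Y X" if "f \<in> hom Y X" for f Y
  proof -
    have "f = Ide A X \<cdot> f" using that by (simp add: hom_iff)
    also have "\<dots> = null Y X" using X that by (auto simp: hom_iff)
    finally show ?thesis .
  qed
  have 2: "f = null X Y" if "f \<in> hom X Y" for f Y
  proof -
    have "f = f \<cdot> Ide A X" using that by (simp add: hom_iff)
    also have "\<dots> = null X Y" using X that by (auto simp: hom_iff)
    finally show ?thesis .
  qed
  have "(\<exists>!f. f \<in> hom Y X) \<and> (\<exists>!f. f \<in> hom X Y)" if Y: "Y \<in> Obj A" for Y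
    using 1[of _ Y] 2[of _ Y] null_in_hom Y X by metis
  then show "zero_object A X" unfolding zero_object_def using X by blast
qed

lemma zero_object_dom:
  "zero_object A X \<Longrightarrow> f \<in> hom X Y \<Longrightarrow> f = null X Y"
  using Obj_of_hom null_in_hom unfolding zero_object_def by (metis)

lemma zero_object_cod:
  "zero_object A X \<Longrightarrow> f \<in> hom Y X \<Longrightarrow> f = null Y X"
  using Obj_of_hom null_in_hom unfolding zero_object_def by (metis)

lemma zero_object_monic:
  assumes "zero_object A X" "monic A f" "f \<in> hom Y X"
  shows "zero_object A Y"
proof -
  have Y: "Y \<in> Obj A" using Obj_of_hom assms by blast
  have "f \<cdot> Ide A Y = null Y X" using zero_object_cod[OF assms(1,3)] assms(3) by (simp add: hom_iff)
  then have "Ide A Y = null Y Y" by (rule monic_null[OF _ assms(2,3)]) (use Y ide_in_Hom in auto)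
  then show ?thesis using Y zero_object_iff by blast
qed

lemma zero_object_epic:
  assumes "zero_object A X" "epic A f" "f \<in> hom X Y"
  shows "zero_object A Y"
proof -
  have Y: "Y \<in> Obj A" using Obj_of_hom assms by blast
  have "Ide A Y \<cdot> f = null X Y" using zero_object_dom[OF assms(1,3)] assms(3) by (simp add: hom_iff)
  then have "Ide A Y = null Y Y" by (rule epic_null[OF _ assms(2,3)]) (use Y ide_in_Hom in auto)
  then show ?thesis using Y zero_object_iff by blast
qed

lemma iso_arr_monic:
  assumes "iso_arr A f" shows "monic A f"
proof -
  have f: "f \<in> hom (Dom A f) (Cod A f)" using assms hom_self by (auto simp: iso_arr_def)
  obtain g where g: "g \<in> hom (Cod A f) (Dom A f)" "g \<cdot> f = Ide A (Dom A f)"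
    using iso_arrE[OF assms f] by blast
  show ?thesis
  proof (rule monicI[OF f])
    fix Z h assume h: "h \<in> hom Z (Dom A f)" "f \<cdot> h = null Z (Cod A f)"
    have Z: "Z \<in> Obj A" using Obj_of_hom h by blast
    have "h = g \<cdot> f \<cdot> h"
      using comp_extend[OF g(2), of h] h(1) f g(1) by (auto simp: hom_iff)
    also have "\<dots> = null Z (Dom A f)" unfolding h(2) using g(1) Z by (auto simp: hom_iff)
    finally show "h = null Z (Dom A f)" .
  qed
qed

lemma iso_arr_epic:
  assumes "iso_arr A f" shows "epic A f"
proof -
  have f: "f \<in> hom (Dom A f) (Cod A f)" using assms hom_self by (auto simp: iso_arr_def)
  obtain g where g: "g \<in> hom (Cod A f) (Dom A f)" "f \<cdot> g = Ide A (Cod A f)"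
    using iso_arrE[OF assms f] by blast
  show ?thesis
  proof (rule epicI[OF f])
    fix Z h assume h: "h \<in> hom (Cod A f) Z" "h \<cdot> f = null (Dom A f) Z"
    have Z: "Z \<in> Obj A" using Obj_of_hom h by blast
    have "h = (h \<cdot> f) \<cdot> g" using h(1) f g by (auto simp: hom_iff)
    also have "\<dots> = null (Cod A f) Z" unfolding h(2) using g(1) Z by (auto simp: hom_iff)
    finally show "h = null (Cod A f) Z" .
  qed
qed

section \<open>Filtrations as iterated extensions\<close>

lemma filtered_0: "filtered A C 0 = {X. zero_object A X}"
proof (intro equalityI subsetI CollectI)
  fix X assume "X \<in> filtered A C 0"
  then obtain s :: "nat \<Rightarrow> 'm" where s: "monic A (s 0)" "Cod A (s 0) = X" "zero_object A (Dom A (s 0))"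
    "iso_arr A (s 0)"
    unfolding filtered_def by auto
  show "zero_object A X"
    by (rule zero_object_epic[OF s(3) iso_arr_epic[OF s(4)]]) 
      (use s hom_self in \<open>auto simp: monic_def\<close>)
next
  fix X assume "X \<in> {X. zero_object A X}"
  then have X: "zero_object A X" "X \<in> Obj A" by (auto simp: zero_object_def)
  have "iso_arr A (Ide A X)"
    by (rule iso_arrI[of _ X X "Ide A X"]) (use X in \<open>auto simp: hom_iff\<close>)
  then show "X \<in> filtered A C 0"
    unfolding filtered_def
    using X iso_arr_monic by (intro CollectI conjI exI[of _ "\<lambda>_. Ide A X"]) auto
qed

text \<open>The recursion behind all inductions on the length of a filtration: its last step exhibits \<open>X\<close> as an
  extension of an object of \<open>C\<close> by an object with a shorter filtration. From left to right, the
  members of the filtration have to be turned from subobjects of \<open>X\<close> into subobjects of the last proper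
  one by composing the inclusions between them.\<close>

lemma filtered_Suc:
  "filtered A C (Suc m) = {X. \<exists>u p. short_exact A u p \<and> Cod A u = X \<and> Dom A u \<in> filtered A C m \<and> Cod A p \<in> C}"
  (is "_ = ?R")
proof (intro equalityI subsetI)
  fix X assume "X \<in> filtered A C (Suc m)"
  then obtain s t q where X: "X \<in> Obj A" and s: "\<And>j. j \<le> Suc m \<Longrightarrow> monic A (s j)" 
      "\<And>j. j \<le> Suc m \<Longrightarrow> Cod A (s j) = X"
    and z: "zero_object A (Dom A (s 0))" and i: "iso_arr A (s (Suc m))"
    and t: "\<And>j. j < Suc m \<Longrightarrow> t j \<in> hom (Dom A (s j)) (Dom A (s (Suc j)))"
      "\<And>j. j < Suc m \<Longrightarrow> s (Suc j) \<cdot> t j = s j"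
      "\<And>j. j < Suc m \<Longrightarrow> is_cokernel A (t j) (q j)" "\<And>j. j < Suc m \<Longrightarrow> Cod A (q j) \<in> C"
    unfolding filtered_def mem_Collect_eq by blast
  have sh: "s j \<in> hom (Dom A (s j)) X" if "j \<le> Suc m" for j
    using s[OF that] by (simp add: monic_def hom_iff)
  let ?X' = "Dom A (s m)"
  \<comment> \<open>Each \<open>s j\<close> factors through \<open>s m\<close>, by downward induction along the inclusions \<open>t j\<close>.\<close>
  have "\<exists>h. h \<in> hom (Dom A (s (m - j))) ?X' \<and> s m \<cdot> h = s (m - j)" if "j \<le> m" for j
    using that
  proof (induction j)
    case 0
    show ?case using sh[of m] by (intro exI[of _ "Ide A ?X'"]) (auto simp: hom_iff)
  next
    case (Suc j)
    then obtain h where h: "h \<in> hom (Dom A (s (m - j))) ?X'" "s m \<cdot> h = s (m - j)" by auto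
    let ?l = "m - Suc j"
    have l: "Suc ?l = m - j" "?l < Suc m" using Suc.prems by auto
    have tl: "t ?l \<in> hom (Dom A (s ?l)) (Dom A (s (m - j)))" "s (m - j) \<cdot> t ?l = s ?l"
      using t(1,2)[OF l(2)] unfolding l(1) by auto
    have "h \<cdot> t ?l \<in> hom (Dom A (s ?l)) ?X'" using comp_in_Hom tl h by blast
    moreover have "s m \<cdot> h \<cdot> t ?l = s ?l"
      using comp_extend[OF h(2), of "t ?l"] h(1) tl sh[of m] by (simp add: hom_iff)
    ultimately show ?case by blast
  qed
  then have "\<exists>h. h \<in> hom (Dom A (s j)) ?X' \<and> s m \<cdot> h = s j" if "j \<le> m" for j
    using that by (metis diff_diff_cancel diff_le_self)
  then obtain s' where s': "\<And>j. j \<le> m \<Longrightarrow> s' j \<in> hom (Dom A (s j)) ?X'" "\<And>j. j \<le> m \<Longrightarrow> s m \<cdot> s' j = s j"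
    by metis
  have dom: "Dom A (s' j) = Dom A (s j)" if "j \<le> m" for j using s'(1)[OF that] by (simp add: hom_iff)
  have X': "?X' \<in> Obj A" using Obj_of_hom sh[of m] by auto
  have mon: "monic A (s m)" "s m \<in> hom ?X' X" using s sh by auto
  have "?X' \<in> filtered A C m"
    unfolding filtered_def
  proof (rule CollectI, rule conjI[OF X'], rule exI[of _ s'], rule exI[of _ t], rule exI[of _ q],
      intro conjI allI impI)
    show "monic A (s' j)" if j: "j \<le> m" for j
    proof (rule monicI[OF s'(1)[OF j]])
      fix Z h assume h: "h \<in> hom Z (Dom A (s j))" "s' j \<cdot> h = null Z ?X'"
      have Z: "Z \<in> Obj A" using Obj_of_hom h by blast
      have "s j \<cdot> h = s m \<cdot> s' j \<cdot> h"
        using comp_extend[OF s'(2)[OF j], of h] h(1) s'(1)[OF j] mon(2) by (auto simp: hom_iff)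
      also have "\<dots> = null Z X" unfolding h(2) using mon(2) Z by (auto simp: hom_iff)
      finally show "h = null Z (Dom A (s j))"
        by (rule monic_null) (use h j s sh in auto)
    qed
    show "Cod A (s' j) = ?X'" if "j \<le> m" for j using s'(1)[OF that] by (simp add: hom_iff)
    show "zero_object A (Dom A (s' 0))" using z dom by simp
    have "s' m = Ide A ?X'"
      by (rule monic_cancel[OF mon s'(1)[of m]]) (use s'(2)[of m] mon(2) ide_in_Hom X' in \<open>auto simp: hom_iff\<close>)
    then show "iso_arr A (s' m)" using iso_arrI[of "Ide A ?X'" ?X' ?X' "Ide A ?X'"] X' by (simp add: hom_iff)
    fix j assume j: "j < m"
    have tj: "t j \<in> hom (Dom A (s j)) (Dom A (s (Suc j)))" using t j by auto
    then show "t j \<in> hom (Dom A (s' j)) (Dom A (s' (Suc j)))" using j dom by auto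
    have s'j: "s' j \<in> hom (Dom A (s j)) ?X'" "s' (Suc j) \<in> hom (Dom A (s (Suc j))) ?X'"
      "s m \<cdot> s' j = s j" "s m \<cdot> s' (Suc j) = s (Suc j)" using s' j by auto
    show "s' (Suc j) \<cdot> t j = s' j"
    proof (rule monic_cancel[OF mon comp_in_Hom[OF tj s'j(2)] s'j(1)])
      show "s m \<cdot> s' (Suc j) \<cdot> t j = s m \<cdot> s' j"
        using comp_extend[OF s'j(4), of "t j"] t(2)[of j] j tj s'j mon(2) by (simp add: hom_iff)
    qed
    show "is_cokernel A (t j) (q j)" "Cod A (q j) \<in> C" using t j by auto
  qed
  moreover
  \<comment> \<open>The last member of the filtration is only isomorphic to \<open>X\<close>, so its quotient is carried
    along the inverse \<open>b\<close> of \<open>s (Suc m)\<close>.\<close>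
  obtain b where b: "b \<in> hom X (Dom A (s (Suc m)))" "b \<cdot> s (Suc m) = Ide A (Dom A (s (Suc m)))" 
      "s (Suc m) \<cdot> b = Ide A X"
    using iso_arrE[OF i sh] by blast
  let ?q = "q m"
  have tm: "t m \<in> hom ?X' (Dom A (s (Suc m)))" "s (Suc m) \<cdot> t m = s m" "is_cokernel A (t m) ?q" "Cod A ?q \<in> C"
    using t[of m] by auto
  note Q = cokernelD[OF tm(3,1)]
  have S: "s (Suc m) \<in> hom (Dom A (s (Suc m))) X" using sh by auto
  have "is_cokernel A (s m) (?q \<cdot> b)"
    using cokernel_postcomp_iso[OF tm(3,1) S b] tm(2) by simp
  then have "short_exact A (s m) (?q \<cdot> b)" using short_exactI_monic mon by blast
  moreover have "Cod A (?q \<cdot> b) \<in> C" using tm(4) Q(1) b(1) by (simp add: hom_iff)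
  ultimately show "X \<in> ?R" using s(2)[of m] by auto
next
  fix X assume "X \<in> ?R"
  then obtain u p where up: "short_exact A u p" "Cod A u = X" "Dom A u \<in> filtered A C m" "Cod A p \<in> C" by blast
  let ?X' = "Dom A u"
  have u: "u \<in> hom ?X' X" and p: "p \<in> hom X (Cod A p)"
    using short_exactE[OF up(1)] up(2) by (metis hom_iff)+
  note E = short_exactD[OF up(1) u p]
  have XO: "X \<in> Obj A" using Obj_of_hom u by blast
  obtain s t q where s: "\<And>j. j \<le> m \<Longrightarrow> monic A (s j)" "\<And>j. j \<le> m \<Longrightarrow> Cod A (s j) = ?X'"
    and z: "zero_object A (Dom A (s 0))" and i: "iso_arr A (s m)"
    and t: "\<And>j. j < m \<Longrightarrow> t j \<in> hom (Dom A (s j)) (Dom A (s (Suc j)))"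
      "\<And>j. j < m \<Longrightarrow> s (Suc j) \<cdot> t j = s j"
      "\<And>j. j < m \<Longrightarrow> is_cokernel A (t j) (q j)" "\<And>j. j < m \<Longrightarrow> Cod A (q j) \<in> C"
    using up(3) unfolding filtered_def mem_Collect_eq by blast
  have sh: "s j \<in> hom (Dom A (s j)) ?X'" if "j \<le> m" for j
    using s[OF that] by (simp add: monic_def hom_iff)
  let ?s = "\<lambda>j. if j \<le> m then u \<cdot> s j else Ide A X"
  let ?t = "\<lambda>j. if j < m then t j else u \<cdot> s m"
  let ?q = "\<lambda>j. if j < m then q j else p"
  have us: "u \<cdot> s j \<in> hom (Dom A (s j)) X" if "j \<le> m" for j using u sh[OF that] comp_in_Hom by blast
  have ideX: "iso_arr A (Ide A X)"
    by (rule iso_arrI[of _ X X "Ide A X"]) (use XO in \<open>auto simp: hom_iff\<close>)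
  show "X \<in> filtered A C (Suc m)"
    unfolding filtered_def
  proof (rule CollectI, rule conjI[OF XO], rule exI[of _ ?s], rule exI[of _ ?t], rule exI[of _ ?q],
      intro conjI allI impI)
    show "monic A (?s j)" for j
    proof (cases "j \<le> m")
      case True
      have "monic A (u \<cdot> s j)"
      proof (rule monicI[OF us[OF True]])
        fix Z h assume h: "h \<in> hom Z (Dom A (s j))" "(u \<cdot> s j) \<cdot> h = null Z X"
        have "u \<cdot> s j \<cdot> h = null Z X" using h u sh[OF True] by (simp add: hom_iff)
        then have "s j \<cdot> h = null Z ?X'" by (rule monic_null[OF _ E(2) u]) (rule comp_in_Hom[OF h(1) sh[OF True]])
        then show "h = null Z (Dom A (s j))"
          by (rule monic_null[OF _ s(1)[OF True] sh[OF True] h(1)])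
      qed
      then show ?thesis using True by simp
    next
      case False
      then show ?thesis using iso_arr_monic[OF ideX] by simp
    qed
    show "Cod A (?s j) = X" for j using us[of j] XO by (auto simp: hom_iff)
    show "zero_object A (Dom A (?s 0))" using z us[of 0] by (simp add: hom_iff)
    show "iso_arr A (?s (Suc m))" using ideX by simp
    fix j assume "j < Suc m"
    then consider "j < m" | "j = m" by linarith
    then have "?t j \<in> hom (Dom A (?s j)) (Dom A (?s (Suc j))) \<and> ?s (Suc j) \<cdot> ?t j = ?s j \<and>
        is_cokernel A (?t j) (?q j) \<and> Cod A (?q j) \<in> C"
    proof cases
      case 1
      then show ?thesis using t[OF 1] sh[of j] sh[of "Suc j"] us[of j] us[of "Suc j"] u
        by (simp add: hom_iff)
    next
      case 2
      have "is_cokernel A (u \<cdot> s m) p"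
        using cokernel_comp_epic[OF E(5) u iso_arr_epic[OF i] sh] by auto
      then show ?thesis using 2 us[of m] up(4) XO by (simp add: hom_iff)
    qed
    then show "?t j \<in> hom (Dom A (?s j)) (Dom A (?s (Suc j)))" "?s (Suc j) \<cdot> ?t j = ?s j"
        "is_cokernel A (?t j) (?q j)" "Cod A (?q j) \<in> C" by auto
  qed
qed

end

section \<open>Exactness of finite direct sums\<close>

context abelian_category
begin

text \<open>Right exactness is formal; that \<open>v\<close> is monic needs the projections of the biproducts, which
  intertwine \<open>v\<close> with the maps \<open>u k\<close>.\<close>

lemma direct_sum_short_exact:
  assumes e: "\<And>k. k < n \<Longrightarrow> short_exact A (u k) (p k)"
      "\<And>k. k < n \<Longrightarrow> u k \<in> hom (Y' k) (Y k)" "\<And>k. k < n \<Longrightarrow> p k \<in> hom (Y k) (Y'' k)"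
    and d: "is_direct_sum A n Y' X' i'" "is_direct_sum A n Y X i" "is_direct_sum A n Y'' X'' i''"
  obtains v w where "short_exact A v w" "v \<in> hom X' X" "w \<in> hom X X''"
proof -
  note E = short_exactD[OF e]
  note D' = direct_sumD[OF d(1)] and D = direct_sumD[OF d(2)] and D'' = direct_sumD[OF d(3)]
  obtain v where v: "v \<in> hom X' X" "\<And>k. k < n \<Longrightarrow> v \<cdot> i' k = i k \<cdot> u k"
    by (rule direct_sum_copair[OF d(1) D(1), of "\<lambda>k. i k \<cdot> u k"]) (use comp_in_Hom[OF e(2) D(3)] in auto)
  obtain w where w: "w \<in> hom X X''" "\<And>k. k < n \<Longrightarrow> w \<cdot> i k = i'' k \<cdot> p k"
    by (rule direct_sum_copair[OF d(2) D''(1), of "\<lambda>k. i'' k \<cdot> p k"]) (use comp_in_Hom[OF e(3) D''(3)] in auto)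
  have "is_cokernel A v w"
  proof (rule cokernelI[OF v(1) w(1)])
    show "w \<cdot> v = null X' X''"
    proof (rule direct_sum_ext[OF d(1) comp_in_Hom[OF v(1) w(1)] null_in_hom[OF D'(1) D''(1)]])
      fix k assume k: "k < n"
      have "(w \<cdot> v) \<cdot> i' k = w \<cdot> i k \<cdot> u k"
        using v(1) v(2)[OF k] w(1) D'(3)[OF k] by (simp add: hom_iff)
      also have "\<dots> = i'' k \<cdot> p k \<cdot> u k"
        using comp_extend[OF w(2)[OF k], of "u k"] w(1) D(3)[OF k] D''(3)[OF k] e(2,3)[OF k]
        by (simp add: hom_iff)
      also have "\<dots> = null X' X'' \<cdot> i' k"
        unfolding E(1)[OF k k k] using D'(2)[OF k] D'(3)[OF k] D''(3)[OF k] D'(1) D''(1) 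
        by (auto simp: hom_iff)
      finally show "(w \<cdot> v) \<cdot> i' k = null X' X'' \<cdot> i' k" .
    qed
    show "epic A w"
    proof (rule epicI[OF w(1)])
      fix Z h assume h: "h \<in> hom X'' Z" "h \<cdot> w = null X Z"
      have Z: "Z \<in> Obj A" using Obj_of_hom h by blast
      show "h = null X'' Z"
      proof (rule direct_sum_ext[OF d(3) h(1)])
        fix k assume k: "k < n"
        have "(h \<cdot> i'' k) \<cdot> p k = (h \<cdot> w) \<cdot> i k"
          using w(1) w(2)[OF k] h(1) D(3)[OF k] D''(3)[OF k] e(3)[OF k] by (simp add: hom_iff)
        also have "\<dots> = null (Y k) Z" unfolding h(2) using D(3)[OF k] Z by (auto simp: hom_iff)
        finally have "h \<cdot> i'' k = null (Y'' k) Z"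
          by (rule epic_null[OF _ E(3)[OF k k k] e(3)[OF k] comp_in_Hom[OF D''(3)[OF k] h(1)]])
        then show "h \<cdot> i'' k = null X'' Z \<cdot> i'' k"
          using D''(1) D''(3)[OF k] Z by (auto simp: hom_iff)
      qed (use null_in_hom D'' Z in auto)
    qed
    fix Z g assume g: "g \<in> hom X Z" "g \<cdot> v = null X' Z"
    have Z: "Z \<in> Obj A" using Obj_of_hom g by blast
    have "\<exists>h. h \<in> hom (Y'' k) Z \<and> h \<cdot> p k = g \<cdot> i k" if k: "k < n" for k
    proof -
      have gi: "g \<cdot> i k \<in> hom (Y k) Z" using comp_in_Hom[OF D(3)[OF k] g(1)] .
      have "(g \<cdot> i k) \<cdot> u k = (g \<cdot> v) \<cdot> i' k"
        using v(1) v(2)[OF k] g(1) D(3)[OF k] D'(3)[OF k] e(2)[OF k] by (simp add: hom_iff)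
      also have "\<dots> = null (Y' k) Z" unfolding g(2) using D'(3)[OF k] Z by (auto simp: hom_iff)
      finally show ?thesis
        using cokernel_lift[OF E(5)[OF k k k] e(2)[OF k] gi] e(3)[OF k] by (metis hom_iff)
    qed
    then obtain h where h: "\<And>k. k < n \<Longrightarrow> h k \<in> hom (Y'' k) Z" "\<And>k. k < n \<Longrightarrow> h k \<cdot> p k = g \<cdot> i k"
      by metis
    obtain h' where h': "h' \<in> hom X'' Z" "\<And>k. k < n \<Longrightarrow> h' \<cdot> i'' k = h k"
      using direct_sum_copair[OF d(3) Z h(1)] by blast
    have "h' \<cdot> w = g"
    proof (rule direct_sum_ext[OF d(2) comp_in_Hom[OF w(1) h'(1)] g(1)])
      fix k assume k: "k < n"
      have "(h' \<cdot> w) \<cdot> i k = (h' \<cdot> i'' k) \<cdot> p k"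
        using w(1) w(2)[OF k] h'(1) D(3)[OF k] D''(3)[OF k] e(3)[OF k] by (simp add: hom_iff)
      then show "(h' \<cdot> w) \<cdot> i k = g \<cdot> i k" unfolding h'(2)[OF k] h(2)[OF k] .
    qed
    then show "\<exists>h. h \<in> hom X'' Z \<and> h \<cdot> w = g" using h' by blast
  qed
  moreover have "monic A v"
  proof -
    obtain r' where r': "is_biproduct n Y' X' i' r'" by (rule direct_sum_biproduct[OF d(1)])
    obtain r where r: "is_biproduct n Y X i r" by (rule direct_sum_biproduct[OF d(2)])
    note B' = biproductD[OF r'] and B = biproductD[OF r]
    have rv: "r k \<cdot> v = u k \<cdot> r' k" if k: "k < n" for k
    proof (rule direct_sum_ext[OF d(1) comp_in_Hom[OF v(1) B(4)[OF k]] comp_in_Hom[OF B'(4)[OF k] e(2)[OF k]]])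
      fix l assume l: "l < n"
      have "(r k \<cdot> v) \<cdot> i' l = (r k \<cdot> i l) \<cdot> u l"
        using v(1) v(2)[OF l] B(4)[OF k] B(3)[OF l] B'(3)[OF l] e(2)[OF l] by (simp add: hom_iff)
      also have "\<dots> = u k \<cdot> r' k \<cdot> i' l"
        unfolding B(5)[OF k l] B'(5)[OF k l] using e(2)[OF k] e(2)[OF l] B(2)[OF k] B'(2)[OF l] by (auto simp: hom_iff)
      also have "\<dots> = (u k \<cdot> r' k) \<cdot> i' l"
        using e(2)[OF k] B'(4)[OF k] B'(3)[OF l] by (simp add: hom_iff)
      finally show "(r k \<cdot> v) \<cdot> i' l = (u k \<cdot> r' k) \<cdot> i' l" .
    qed
    show ?thesis
    proof (rule monicI[OF v(1)])
      fix T a assume a: "a \<in> hom T X'" "v \<cdot> a = null T X"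
      have T: "T \<in> Obj A" using Obj_of_hom a by blast
      show "a = null T X'"
      proof (rule biproduct_projections_jointly_monic[OF r' a(1)])
        fix k assume k: "k < n"
        have "u k \<cdot> r' k \<cdot> a = r k \<cdot> v \<cdot> a"
          using comp_extend[OF rv[OF k], of a] a(1) v(1) B(4)[OF k] B'(4)[OF k] e(2)[OF k] by (simp add: hom_iff)
        also have "\<dots> = null T (Y k)" unfolding a(2) using B(4)[OF k] T by (auto simp: hom_iff)
        finally show "r' k \<cdot> a = null T (Y' k)"
          by (rule monic_null[OF _ E(2)[OF k k k] e(2)[OF k] comp_in_Hom[OF a(1) B'(4)[OF k]]])
      qed
    qed
  qed
  ultimately show ?thesis using that[OF short_exactI_monic v(1) w(1)] by blast
qed

end

section \<open>Closure of the extension subcategories\<close>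

text \<open>The hypothesis on \<open>C\<close>, bundled so that closure of \<open>C\<close>, of the categories of extensions and of an
  essential image are instances of one predicate.\<close>

locale closed_full_subcategory = abelian_category A
  for A :: "('o, 'm) precat" +
  fixes C :: "'o set"
  assumes repl: "replete A C"
    and sums: "closed_direct_sums A C"
    and kers: "closed_kernels A C"
    and cokers: "closed_cokernels A C"
begin

lemma kernel_closed:
  "X \<in> C \<Longrightarrow> Y \<in> C \<Longrightarrow> f \<in> hom X Y \<Longrightarrow> is_kernel A f k \<Longrightarrow> Dom A k \<in> C"
  using kers unfolding closed_kernels_def by blast

lemma cokernel_closed:
  "X \<in> C \<Longrightarrow> Y \<in> C \<Longrightarrow> f \<in> hom X Y \<Longrightarrow> is_cokernel A f q \<Longrightarrow> Cod A q \<in> C"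
  using cokers unfolding closed_cokernels_def by blast

text \<open>A zero object is the direct sum of the empty family.\<close>

lemma zero_object_closed:
  assumes "zero_object A X" shows "X \<in> C"
proof -
  have "is_direct_sum A 0 (\<lambda>_. X) X (\<lambda>_. Ide A X)"
    using assms unfolding is_direct_sum_def zero_object_def by auto
  then show ?thesis using sums unfolding closed_direct_sums_def by blast
qed

lemma filtered_SucI:
  assumes "short_exact A u p" "u \<in> hom X' X" "p \<in> hom X X''" "X' \<in> filtered A C m" "X'' \<in> C"
  shows "X \<in> filtered A C (Suc m)"
  unfolding filtered_Suc using assms by (auto simp: hom_iff)

lemma filtered_SucE:
  assumes "X \<in> filtered A C (Suc m)"
  obtains u p X' X'' where "short_exact A u p" "u \<in> hom X' X" "p \<in> hom X X''" 
    "X' \<in> filtered A C m" "X'' \<in> C"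
proof -
  obtain u p where up: "short_exact A u p" "Cod A u = X" "Dom A u \<in> filtered A C m" "Cod A p \<in> C"
    using assms unfolding filtered_Suc by blast
  then show ?thesis using that[of u p "Dom A u" "Cod A p"] short_exactE[OF up(1)] by (metis hom_iff)
qed

lemma filtered_Obj: "X \<in> filtered A C m \<Longrightarrow> X \<in> Obj A"
  unfolding filtered_def by simp

lemma filtered_isomorphic:
  assumes "X \<in> filtered A C m" "isomorphic A X Y"
  shows "Y \<in> filtered A C m"
proof -
  obtain a b where a: "a \<in> hom X Y" "b \<in> hom Y X" "b \<cdot> a = Ide A X" "a \<cdot> b = Ide A Y"
    using assms(2) by (rule isomorphicE)
  have iso: "iso_arr A a" "iso_arr A b" using iso_arrI a by blast+
  show ?thesis
  proof (cases m)
    case 0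
    then have "zero_object A X" using assms(1) filtered_0 by auto
    then have "zero_object A Y" by (rule zero_object_epic[OF _ iso_arr_epic[OF iso(1)] a(1)])
    then show ?thesis using 0 filtered_0 by auto
  next
    case (Suc n)
    then obtain u p X' X'' where e: "short_exact A u p" "u \<in> hom X' X" "p \<in> hom X X''" 
        "X' \<in> filtered A C n" "X'' \<in> C"
      using assms(1) filtered_SucE by blast
    note E = short_exactD[OF e(1-3)]
    have au: "a \<cdot> u \<in> hom X' Y" using e(2) a(1) comp_in_Hom by blast
    have "monic A (a \<cdot> u)"
      by (rule kernelD(3)[OF kernel_precomp_iso[OF E(4) e(3) a(2,1) a(4,3)] comp_in_Hom[OF a(2) e(3)]])
    then have "short_exact A (a \<cdot> u) (p \<cdot> b)"
      using short_exactI_monic cokernel_postcomp_iso[OF E(5) e(2) a] by blast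
    then show ?thesis unfolding Suc
      by (rule filtered_SucI[OF _ au comp_in_Hom[OF a(2) e(3)] e(4,5)])
  qed
qed

text \<open>Induction on the filtration of the source. With \<open>0 \<rightarrow> X' \<rightarrow> X \<rightarrow> X'' \<rightarrow> 0\<close>, the
  restriction of \<open>f\<close> to \<open>X'\<close> has its kernel in the shorter extension category and its cokernel in \<open>C\<close>,
  so that the induced map from \<open>X''\<close> to that cokernel is a morphism in \<open>C\<close>. Its cokernel is that of \<open>f\<close>,
  and its kernel is the top layer of a filtration of \<open>ker f\<close>.\<close>

lemma filtered_kernel_cokernel_into_C:
  assumes "X \<in> filtered A C n" "Y \<in> C" "f \<in> hom X Y"
  shows "(\<forall>k. is_kernel A f k \<longrightarrow> Dom A k \<in> filtered A C n) \<and>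
    (\<forall>r. is_cokernel A f r \<longrightarrow> Cod A r \<in> C)"
  using assms(1,3)
proof (induction n arbitrary: X f)
  case 0
  then have X: "zero_object A X" using filtered_0 by auto
  have "Dom A k \<in> filtered A C 0" if "is_kernel A f k" for k
    using zero_object_monic[OF X] kernelD[OF that 0(2)] filtered_0 by blast
  then show ?case using cokernel_closed[OF zero_object_closed[OF X] \<open>Y \<in> C\<close> 0(2)] by blast
next
  case (Suc n)
  note f = \<open>f \<in> hom X Y\<close>
  obtain u p X' X'' where e: "short_exact A u p" "u \<in> hom X' X" "p \<in> hom X X''" 
      "X' \<in> filtered A C n" "X'' \<in> C"
    using Suc.prems(1) filtered_SucE by blast
  note E = short_exactD[OF e(1-3)]
  have fu: "f \<cdot> u \<in> hom X' Y" using f e comp_in_Hom by blast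
  obtain k' where k': "is_kernel A (f \<cdot> u) k'" using obtain_kernel[OF fu] by blast
  obtain q where q: "is_cokernel A (f \<cdot> u) q" "q \<in> hom Y (Cod A q)" "q \<cdot> f \<cdot> u = null X' (Cod A q)"
    using obtain_cokernel[OF fu] by blast
  have K': "Dom A k' \<in> filtered A C n" and Q: "Cod A q \<in> C"
    using Suc.IH k' q e(4) \<open>Y \<in> C\<close> fu by blast+
  have "(q \<cdot> f) \<cdot> u = null X' (Cod A q)" using q e(2) f by (simp add: hom_iff)
  then obtain g where g: "g \<in> hom X'' (Cod A q)" "g \<cdot> p = q \<cdot> f"
    using cokernel_lift[OF E(5) e(2) comp_in_Hom[OF f q(2)]] e(3) by (metis hom_iff)
  have "Dom A k \<in> filtered A C (Suc n)" if k: "is_kernel A f k" for k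
  proof -
    obtain l where l: "is_kernel A g l" using obtain_kernel[OF g(1)] by blast
    obtain a b where ab: "short_exact A a b" "a \<in> hom (Dom A k') (Dom A k)" "b \<in> hom (Dom A k) (Dom A l)"
      using kernel_short_exact[OF e(1-3) f k' q(1) g k l] .
    show ?thesis by (rule filtered_SucI[OF ab K' kernel_closed[OF e(5) Q g(1) l]])
  qed
  moreover have "Cod A r \<in> C" if r: "is_cokernel A f r" for r
  proof -
    obtain r' where "is_cokernel A g r'" "Cod A r' = Cod A r"
      using cokernel_of_quotient_map[OF e(1-3) f q(1) g r] .
    then show ?thesis using cokernel_closed[OF e(5) Q g(1)] by metis
  qed
  ultimately show ?case by blast
qed

text \<open>Induction on the filtration of the target, for a source with a filtration of arbitrary
  length. With \<open>0 \<rightarrow> Y' \<rightarrow> Y \<rightarrow> Y'' \<rightarrow> 0\<close>, the composite \<open>X \<rightarrow> Y''\<close> is covered by the previous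
  lemma; its kernel has a filtration as long as that of \<open>X\<close> and maps to \<open>Y'\<close>, to which the induction
  hypothesis applies. The length for the source stays fixed while the one for the target decreases,
  so the statement needs two independent lengths.\<close>

lemma filtered_kernel_cokernel:
  assumes "X \<in> filtered A C n" "Y \<in> filtered A C m" "f \<in> hom X Y"
  shows "(\<forall>k. is_kernel A f k \<longrightarrow> Dom A k \<in> filtered A C n) \<and>
    (\<forall>r. is_cokernel A f r \<longrightarrow> Cod A r \<in> filtered A C m)"
  using assms
proof (induction m arbitrary: X Y f)
  case 0
  then have Y: "zero_object A Y" using filtered_0 by auto
  have X: "X \<in> Obj A" using filtered_Obj 0 by blast
  have f0: "f = null X Y" by (rule zero_object_cod[OF Y 0(3)])
  have "is_kernel A f (Ide A X)"
  proof (rule kernelI[OF 0(3)])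
    show "monic A (Ide A X)" 
      by (rule iso_arr_monic, rule iso_arrI[of _ X X "Ide A X"]) (use X in \<open>auto simp: hom_iff\<close>)
    show "\<exists>h. h \<in> hom Z X \<and> Ide A X \<cdot> h = g" if "g \<in> hom Z X" for Z g
      using that by (intro exI[of _ g]) (simp add: hom_iff)
  qed (use X 0(3) f0 in \<open>auto simp: hom_iff\<close>)
  then have "Dom A k \<in> filtered A C n" if "is_kernel A f k" for k
    using filtered_isomorphic[OF 0(1)] kernel_unique[OF _ that] X by force
  moreover have "Cod A r \<in> filtered A C 0" if "is_cokernel A f r" for r
    using zero_object_epic[OF Y] cokernelD[OF that 0(3)] filtered_0 by blast
  ultimately show ?case by blast
next
  case (Suc m)
  note f = \<open>f \<in> hom X Y\<close>
  obtain u v Y' Y'' where e: "short_exact A u v" "u \<in> hom Y' Y" "v \<in> hom Y Y''" 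
      "Y' \<in> filtered A C m" "Y'' \<in> C"
    using Suc.prems(2) filtered_SucE by blast
  note E = short_exactD[OF e(1-3)]
  have vf: "v \<cdot> f \<in> hom X Y''" using f e comp_in_Hom by blast
  obtain k' where k': "is_kernel A (v \<cdot> f) k'" "k' \<in> hom (Dom A k') X" "(v \<cdot> f) \<cdot> k' = null (Dom A k') Y''"
    using obtain_kernel[OF vf] by blast
  obtain q where q: "is_cokernel A (v \<cdot> f) q"
    using obtain_cokernel[OF vf] by blast
  have K': "Dom A k' \<in> filtered A C n" and Q: "Cod A q \<in> C"
    using filtered_kernel_cokernel_into_C[OF Suc.prems(1) e(5) vf] k'(1) q by blast+
  have "v \<cdot> f \<cdot> k' = null (Dom A k') Y''" using k' e(3) f by (simp add: hom_iff)
  then obtain g where g: "g \<in> hom (Dom A k') Y'" "u \<cdot> g = f \<cdot> k'"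
    using kernel_lift[OF E(4) e(3) comp_in_Hom[OF k'(2) f]] e(2) by (metis hom_iff)
  note IH = Suc.IH[OF K' e(4) g(1)]
  have "Dom A k \<in> filtered A C n" if k: "is_kernel A f k" for k
  proof -
    obtain s where "is_kernel A g s" "Dom A s = Dom A k"
      using kernel_of_corestriction[OF e(1-3) f k'(1) g k] .
    then show ?thesis using IH by metis
  qed
  moreover have "Cod A r \<in> filtered A C (Suc m)" if r: "is_cokernel A f r" for r
  proof -
    obtain c where c: "is_cokernel A g c" using obtain_cokernel[OF g(1)] by blast
    obtain a b where ab: "short_exact A a b" "a \<in> hom (Cod A c) (Cod A r)" "b \<in> hom (Cod A r) (Cod A q)"
      using cokernel_short_exact[OF e(1-3) f k'(1) q g r c] .
    show ?thesis by (rule filtered_SucI[OF ab]) (use IH c Q in auto)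
  qed
  ultimately show ?case by blast
qed

text \<open>By exactness of finite direct sums, the layers of a sum of filtrations are the sums of the layers.\<close>

lemma filtered_direct_sum:
  assumes "\<And>k. k < n \<Longrightarrow> Y k \<in> filtered A C m" "is_direct_sum A n Y X i"
  shows "X \<in> filtered A C m"
  using assms
proof (induction m arbitrary: X Y i)
  case 0
  note D = direct_sumD[OF 0(2)]
  have "Ide A X = null X X"
  proof (rule direct_sum_ext[OF 0(2) ide_in_Hom[OF D(1)] null_in_hom[OF D(1) D(1)]])
    fix k assume k: "k < n"
    have "zero_object A (Y k)" using 0(1)[OF k] filtered_0 by auto
    then have "i k = null (Y k) X" using zero_object_dom D(3)[OF k] by blast
    then show "Ide A X \<cdot> i k = null X X \<cdot> i k" using D(1) D(2)[OF k] by simp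
  qed
  then show ?case using D(1) zero_object_iff filtered_0 by auto
next
  case (Suc m)
  have "\<exists>u p Y' Y''. short_exact A u p \<and> u \<in> hom Y' (Y k) \<and> p \<in> hom (Y k) Y'' \<and>
      Y' \<in> filtered A C m \<and> Y'' \<in> C" if "k < n" for k
    using Suc.prems(1)[OF that] filtered_SucE by metis
  then obtain u p Y' Y'' where e: "\<And>k. k < n \<Longrightarrow> short_exact A (u k) (p k)"
      "\<And>k. k < n \<Longrightarrow> u k \<in> hom (Y' k) (Y k)" "\<And>k. k < n \<Longrightarrow> p k \<in> hom (Y k) (Y'' k)"
      "\<And>k. k < n \<Longrightarrow> Y' k \<in> filtered A C m" "\<And>k. k < n \<Longrightarrow> Y'' k \<in> C"
    by metis
  obtain X' i' where d': "is_direct_sum A n Y' X' i'"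
    using has_direct_sums[of n Y'] e(4) filtered_Obj by metis
  obtain X'' i'' where d'': "is_direct_sum A n Y'' X'' i''"
    using has_direct_sums[of n Y''] e(3) Obj_of_hom by metis
  obtain v w where vw: "short_exact A v w" "v \<in> hom X' X" "w \<in> hom X X''"
    using direct_sum_short_exact[OF e(1-3) d' Suc.prems(2) d''] by blast
  have "X'' \<in> C" using sums d'' e(5) unfolding closed_direct_sums_def by blast
  then show ?case using filtered_SucI[OF vw Suc.IH[OF e(4) d']] by blast
qed

theorem closed_full_subcategory_filtered:
  "closed_full_subcategory A (filtered A C m)"
proof unfold_locales
  show "replete A (filtered A C m)"
    unfolding replete_def using filtered_Obj filtered_isomorphic by blast
  show "closed_direct_sums A (filtered A C m)"
    unfolding closed_direct_sums_def using filtered_direct_sum by blast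
  show "closed_kernels A (filtered A C m)" "closed_cokernels A (filtered A C m)"
    unfolding closed_kernels_def closed_cokernels_def using filtered_kernel_cokernel by blast+
qed

end

section \<open>Full subcategories closed under direct sums, kernels and cokernels are abelian\<close>

lemma full_subcat_simps [simp]:
  "Obj (full_subcat A C) = C" "Dom (full_subcat A C) = Dom A" "Cod (full_subcat A C) = Cod A"
  "Ide (full_subcat A C) = Ide A" "Comp (full_subcat A C) = Comp A" "Add (full_subcat A C) = Add A"
  "Zero (full_subcat A C) = Zero A"
  "f \<in> Arr (full_subcat A C) \<longleftrightarrow> f \<in> Arr A \<and> Dom A f \<in> C \<and> Cod A f \<in> C"
  by (simp_all add: full_subcat_def)

lemma Hom_full_subcat:
  "f \<in> Hom (full_subcat A C) X Y \<longleftrightarrow> f \<in> Hom A X Y \<and> X \<in> C \<and> Y \<in> C"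
  by (auto simp: Hom_def)

lemma hom_group_full_subcat:
  "X \<in> C \<Longrightarrow> Y \<in> C \<Longrightarrow> hom_group (full_subcat A C) X Y = hom_group A X Y"
  using Hom_full_subcat[of _ A C X Y] by (auto simp: hom_group_def)

context closed_full_subcategory
begin

abbreviation S where "S \<equiv> full_subcat A C"

lemma C_Obj: "X \<in> C \<Longrightarrow> X \<in> Obj A"
  using repl unfolding replete_def by blast

lemma preadditive_full_subcat: "preadditive_category S"
proof (intro preadditive_category.intro category.intro preadditive_category_axioms.intro)
  show "comm_group (hom_group S X Y)" if "X \<in> Obj S" "Y \<in> Obj S" for X Y
    using that hom_comm_group C_Obj by (simp add: hom_group_full_subcat)
qed (use C_Obj comp_in_Hom ide_in_Hom comp_assoc comp_ide_left comp_ide_right comp_add_left comp_add_right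
    in \<open>auto simp: Hom_full_subcat\<close>)

lemma full_subcat_kernelI:
  assumes "is_kernel A f k" "f \<in> hom X Y" "X \<in> C" "Y \<in> C"
  shows "is_kernel S f k"
  using assms kernel_closed[OF assms(3,4,2,1)] unfolding is_kernel_def
  by (auto simp: Hom_full_subcat hom_iff)

lemma full_subcat_cokernelI:
  assumes "is_cokernel A f q" "f \<in> hom X Y" "X \<in> C" "Y \<in> C"
  shows "is_cokernel S f q"
  using assms cokernel_closed[OF assms(3,4,2,1)] unfolding is_cokernel_def
  by (auto simp: Hom_full_subcat hom_iff)

text \<open>A kernel in the subcategory has its universal property only against test objects in \<open>C\<close>. A kernel in \<open>A\<close>
  of the same morphism lies in \<open>C\<close> by closure and is a kernel there, so the two are isomorphic.\<close>

lemma full_subcat_kernelD: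
  assumes k: "is_kernel S f k"
  shows "is_kernel A f k"
proof -
  interpret S: preadditive_category S by (rule preadditive_full_subcat)
  have f: "f \<in> Hom S (Dom A f) (Cod A f)" using k by (simp add: is_kernel_def Hom_full_subcat hom_self)
  then have f': "f \<in> hom (Dom A f) (Cod A f)" "Dom A f \<in> C" "Cod A f \<in> C" by (auto simp: Hom_full_subcat)
  note K = S.kernelD[OF k f, simplified]
  have kh: "k \<in> hom (Dom A k) (Dom A f)" using K(1) by (simp add: Hom_full_subcat)
  obtain l where l: "is_kernel A f l" "l \<in> hom (Dom A l) (Dom A f)" using obtain_kernel[OF f'(1)] by blast
  have l': "is_kernel S f l" by (rule full_subcat_kernelI[OF l(1) f'])
  note L = S.kernelD[OF l' f, simplified]
  obtain a where a: "a \<in> Hom S (Dom A k) (Dom A l)" "l \<cdot> a = k"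
    using S.kernel_lift[OF l' f K(1)] K(2) by auto
  obtain b where b: "b \<in> Hom S (Dom A l) (Dom A k)" "k \<cdot> b = l"
    using S.kernel_lift[OF k f L(1)] L(2) by auto
  have a': "a \<in> hom (Dom A k) (Dom A l)" "b \<in> hom (Dom A l) (Dom A k)"
    "Dom A k \<in> C" "Dom A l \<in> C" using a b by (auto simp: Hom_full_subcat)
  have "b \<cdot> a = Ide A (Dom A k)"
    by (rule S.monic_cancel[OF K(3,1), simplified])
      (use a' kh a(2) comp_extend[OF b(2), of a] C_Obj in \<open>auto simp: Hom_full_subcat hom_iff\<close>)
  moreover have "a \<cdot> b = Ide A (Dom A l)"
    by (rule S.monic_cancel[OF L(3,1), simplified])
      (use a' l(2) b(2) comp_extend[OF a(2), of b] C_Obj in \<open>auto simp: Hom_full_subcat hom_iff\<close>)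
  ultimately show ?thesis using kernel_iso[OF l(1) f'(1) a'(1,2)] a(2) by simp
qed

lemma full_subcat_cokernelD:
  assumes q: "is_cokernel S f q"
  shows "is_cokernel A f q"
proof -
  interpret S: preadditive_category S by (rule preadditive_full_subcat)
  have f: "f \<in> Hom S (Dom A f) (Cod A f)" using q by (simp add: is_cokernel_def Hom_full_subcat hom_self)
  then have f': "f \<in> hom (Dom A f) (Cod A f)" "Dom A f \<in> C" "Cod A f \<in> C" by (auto simp: Hom_full_subcat)
  note Q = S.cokernelD[OF q f, simplified]
  have qh: "q \<in> hom (Cod A f) (Cod A q)" using Q(1) by (simp add: Hom_full_subcat)
  obtain l where l: "is_cokernel A f l" "l \<in> hom (Cod A f) (Cod A l)" using obtain_cokernel[OF f'(1)] by blast
  have l': "is_cokernel S f l" by (rule full_subcat_cokernelI[OF l(1) f'])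
  note L = S.cokernelD[OF l' f, simplified]
  obtain a where a: "a \<in> Hom S (Cod A l) (Cod A q)" "a \<cdot> l = q"
    using S.cokernel_lift[OF l' f Q(1)] Q(2) by auto
  obtain b where b: "b \<in> Hom S (Cod A q) (Cod A l)" "b \<cdot> q = l"
    using S.cokernel_lift[OF q f L(1)] L(2) by auto
  have a': "a \<in> hom (Cod A l) (Cod A q)" "b \<in> hom (Cod A q) (Cod A l)"
    "Cod A q \<in> C" "Cod A l \<in> C" using a b by (auto simp: Hom_full_subcat)
  have "b \<cdot> a = Ide A (Cod A l)"
    by (rule S.epic_cancel[OF L(3,1), simplified])
      (use a' l(2) b(2) a(2) C_Obj in \<open>auto simp: Hom_full_subcat hom_iff\<close>)
  moreover have "a \<cdot> b = Ide A (Cod A q)"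
    by (rule S.epic_cancel[OF Q(3,1), simplified])
      (use a' qh b(2) a(2) C_Obj in \<open>auto simp: Hom_full_subcat hom_iff\<close>)
  ultimately show ?thesis using cokernel_iso[OF l(1) f'(1) a'(1,2)] a(2) by simp
qed

text \<open>The kernel in \<open>A\<close> lies in \<open>C\<close>, so cancellation against objects of \<open>C\<close> suffices to make it zero.\<close>

lemma full_subcat_monicD:
  assumes "monic S f" shows "monic A f"
proof -
  have f: "f \<in> hom (Dom A f) (Cod A f)" "Dom A f \<in> C" "Cod A f \<in> C"
    using assms by (auto simp: monic_def hom_self)
  obtain k where k: "is_kernel A f k" "k \<in> hom (Dom A k) (Dom A f)" "f \<cdot> k = null (Dom A k) (Cod A f)"
    using obtain_kernel[OF f(1)] by blast
  have K: "Dom A k \<in> C" by (rule kernel_closed[OF f(2,3,1) k(1)])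
  have O: "Dom A k \<in> Obj A" "Dom A f \<in> Obj A" using Obj_of_hom k by blast+
  have "f \<cdot> null (Dom A k) (Dom A f) = f \<cdot> k" using k(3) f(1) O by (simp add: hom_iff)
  then have k0: "k = null (Dom A k) (Dom A f)"
    using assms k(2) null_in_hom[OF O] f(2) K unfolding monic_def
    by (metis Hom_full_subcat full_subcat_simps(2,5))
  show ?thesis
  proof (rule monicI[OF f(1)])
    fix Z g assume g: "g \<in> hom Z (Dom A f)" "f \<cdot> g = null Z (Cod A f)"
    obtain h where h: "h \<in> hom Z (Dom A k)" "k \<cdot> h = g" by (rule kernel_lift[OF k(1) f(1) g])
    have "null (Dom A k) (Dom A f) \<cdot> h = null Z (Dom A f)" using h(1) O by (simp add: hom_iff)
    then show "g = null Z (Dom A f)" using h(2) k0 by metis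
  qed
qed

lemma full_subcat_epicD:
  assumes "epic S f" shows "epic A f"
proof -
  have f: "f \<in> hom (Dom A f) (Cod A f)" "Dom A f \<in> C" "Cod A f \<in> C"
    using assms by (auto simp: epic_def hom_self)
  obtain q where q: "is_cokernel A f q" "q \<in> hom (Cod A f) (Cod A q)" "q \<cdot> f = null (Dom A f) (Cod A q)"
    using obtain_cokernel[OF f(1)] by blast
  have Q: "Cod A q \<in> C" by (rule cokernel_closed[OF f(2,3,1) q(1)])
  have O: "Cod A q \<in> Obj A" "Cod A f \<in> Obj A" using Obj_of_hom q by blast+
  have "null (Cod A f) (Cod A q) \<cdot> f = q \<cdot> f" using q(3) f(1) O by (simp add: hom_iff)
  then have q0: "q = null (Cod A f) (Cod A q)"
    using assms q(2) null_in_hom[OF O(2,1)] f(3) Q unfolding epic_def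
    by (metis Hom_full_subcat full_subcat_simps(3,5))
  show ?thesis
  proof (rule epicI[OF f(1)])
    fix Z g assume g: "g \<in> hom (Cod A f) Z" "g \<cdot> f = null (Dom A f) Z"
    obtain h where h: "h \<in> hom (Cod A q) Z" "h \<cdot> q = g" by (rule cokernel_lift[OF q(1) f(1) g])
    have "h \<cdot> null (Cod A f) (Cod A q) = null (Cod A f) Z" using h(1) O by (simp add: hom_iff)
    then show "g = null (Cod A f) Z" using h(2) q0 by metis
  qed
qed

theorem abelian_full_subcat: "abelian_category S"
proof (intro abelian_category.intro abelian_category_axioms.intro preadditive_full_subcat)
  obtain Z where Z: "zero_object A Z" using has_zero_object by blast
  have "(\<exists>!f. f \<in> hom X Z) \<and> (\<exists>!f. f \<in> hom Z X)" if "X \<in> C" for X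
    using Z C_Obj[OF that] unfolding zero_object_def by blast
  then have "zero_object S Z"
    using zero_object_closed[OF Z] unfolding zero_object_def by (simp add: Hom_full_subcat)
  then show "\<exists>Z. zero_object S Z" by blast
next
  fix n :: nat and Y assume Y: "\<And>k. k < n \<Longrightarrow> Y k \<in> Obj S"
  then obtain X i where d: "is_direct_sum A n Y X i" using has_direct_sums[of n Y] C_Obj by auto
  moreover have "X \<in> C" using d sums Y unfolding closed_direct_sums_def by auto
  ultimately have "is_direct_sum S n Y X i"
    using Y C_Obj unfolding is_direct_sum_def by (simp add: Hom_full_subcat)
  then show "\<exists>X i. is_direct_sum S n Y X i" by blast
next
  fix f assume "f \<in> Arr S"
  then have f: "f \<in> hom (Dom A f) (Cod A f)" "Dom A f \<in> C" "Cod A f \<in> C" by (auto simp: hom_self)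
  show "\<exists>k. is_kernel S f k" using obtain_kernel[OF f(1)] full_subcat_kernelI[OF _ f] by metis
  show "\<exists>q. is_cokernel S f q" using obtain_cokernel[OF f(1)] full_subcat_cokernelI[OF _ f] by metis
next
  fix f assume m: "monic S f"
  then have f: "f \<in> hom (Dom A f) (Cod A f)" "Dom A f \<in> C" "Cod A f \<in> C"
    by (auto simp: monic_def hom_self)
  obtain q where q: "is_cokernel A f q" "q \<in> hom (Cod A f) (Cod A q)" using obtain_cokernel[OF f(1)] by blast
  have "is_kernel A q f" by (rule monic_is_kernel_of_cokernel[OF full_subcat_monicD[OF m] f(1) q(1)])
  then show "\<exists>g. is_kernel S g f"
    using full_subcat_kernelI[OF _ q(2) f(3)] cokernel_closed[OF f(2,3,1) q(1)] by blast
next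
  fix f assume e: "epic S f"
  then have f: "f \<in> hom (Dom A f) (Cod A f)" "Dom A f \<in> C" "Cod A f \<in> C"
    by (auto simp: epic_def hom_self)
  obtain k where k: "is_kernel A f k" "k \<in> hom (Dom A k) (Dom A f)" using obtain_kernel[OF f(1)] by blast
  have "is_cokernel A k f" by (rule epic_is_cokernel_of_kernel[OF full_subcat_epicD[OF e] f(1) k(1)])
  then show "\<exists>g. is_cokernel S g f"
    using full_subcat_cokernelI[OF _ k(2) _ f(2)] kernel_closed[OF f(2,3,1) k(1)] by blast
qed

theorem exact_inclusion: "exact_functor S A (\<lambda>X. X) (\<lambda>f. f)"
proof (intro exact_functor.intro additive_functor.intro additive_functor_axioms.intro
    exact_functor_axioms.intro preadditive_full_subcat)
  show "preadditive_category A" by unfold_locales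
  show "short_exact A f g" if "short_exact S f g" for f g
    using that full_subcat_kernelD full_subcat_cokernelD unfolding short_exact_def by blast
qed (use C_Obj in \<open>auto simp: Hom_full_subcat\<close>)

theorem fully_faithful_inclusion: "fully_faithful S A (\<lambda>X. X) (\<lambda>f. f)"
proof -
  have "Hom S X Y = Hom A X Y" if "X \<in> C" "Y \<in> C" for X Y
    using that by (auto simp: Hom_full_subcat)
  then show ?thesis by (auto simp: fully_faithful_def bij_betw_def)
qed

end

section \<open>Essential images of fully faithful exact functors\<close>

locale fully_faithful_exact_functor =
  exact_functor B A FO FA + B: abelian_category B + A: abelian_category A
  for B :: "('p, 'q) precat" and A :: "('o, 'm) precat" and FO FA +
  assumes ff: "fully_faithful B A FO FA"
begin

text \<open>Additivity suffices: \<open>0 + 0 = 0\<close> is preserved, and homomorphism groups have cancellation.\<close>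

lemma map_zero:
  assumes "X \<in> Obj B" "Y \<in> Obj B"
  shows "FA (Zero B X Y) = Zero A (FO X) (FO Y)"
proof -
  let ?z = "Zero B X Y"
  have z: "?z \<in> Hom B X Y" using B.null_in_hom assms .
  have Fz: "FA ?z \<in> Hom A (FO X) (FO Y)" using map_Hom z .
  have Z: "Zero A (FO X) (FO Y) \<in> Hom A (FO X) (FO Y)" using A.null_in_hom map_Obj assms by blast
  have "Add B ?z ?z = ?z" using assms by simp
  then have "Add A (FA ?z) (FA ?z) = FA ?z" using map_add[OF z z] by simp
  also have "\<dots> = Add A (FA ?z) (Zero A (FO X) (FO Y))" using Fz by (simp add: A.hom_iff)
  finally show ?thesis using A.add_cancel_left[OF Fz Fz Z] by blast
qed

lemma obtain_preimage:
  assumes "X \<in> Obj B" "Y \<in> Obj B" "h \<in> Hom A (FO X) (FO Y)"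
  obtains g where "g \<in> Hom B X Y" "FA g = h"
proof -
  have "FA ` Hom B X Y = Hom A (FO X) (FO Y)"
    by (rule bij_betw_imp_surj_on) (use ff assms(1,2) in \<open>simp add: fully_faithful_def\<close>)
  then have "h \<in> FA ` Hom B X Y" using assms(3) by simp
  then obtain g where "h = FA g" "g \<in> Hom B X Y" by (rule imageE)
  then show ?thesis using that[of g] by simp
qed

text \<open>The functor is only known to preserve short exact sequences. Factoring \<open>f\<close> as an epimorphism
  followed by a monomorphism splits the computation of its kernel and cokernel into two such sequences.\<close>

lemma obtain_kernel_cokernel_in_image:
  assumes f: "f \<in> Hom B X Y"
  obtains k q where "k \<in> Arr B" "is_kernel A (FA f) (FA k)" "q \<in> Arr B" "is_cokernel A (FA f) (FA q)"
proof -
  obtain q where q: "is_cokernel B f q" "q \<in> Hom B Y (Cod B q)" using B.obtain_cokernel[OF f] by blast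
  obtain m where m: "is_kernel B q m" "m \<in> Hom B (Dom B m) Y" "monic B m" using B.obtain_kernel[OF q(2)] by blast
  obtain e where e: "e \<in> Hom B X (Dom B m)" "Comp B m e = f" "epic B e"
    using B.image_factorisation[OF f q(1) m(1)] .
  obtain k where k: "is_kernel B e k" "k \<in> Hom B (Dom B k) X" using B.obtain_kernel[OF e(1)] by blast
  obtain p where p: "is_cokernel B m p" "p \<in> Hom B Y (Cod B p)" using B.obtain_cokernel[OF m(2)] by blast
  have "short_exact A (FA k) (FA e)" "short_exact A (FA m) (FA p)"
    using map_short_exact B.short_exactI_epic[OF k(1) e(3)] B.short_exactI_monic[OF p(1) m(3)] by blast+
  note E = A.short_exactD[OF this(1) map_Hom[OF k(2)] map_Hom[OF e(1)]]
    and M = A.short_exactD[OF this(2) map_Hom[OF m(2)] map_Hom[OF p(2)]]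
  have F: "FA f = Comp A (FA m) (FA e)" using map_comp[OF e(1) m(2)] e(2) by simp
  have "is_kernel A (FA f) (FA k)"
    unfolding F by (rule A.kernel_comp_monic[OF E(4) map_Hom[OF e(1)] M(2) map_Hom[OF m(2)]])
  moreover have "is_cokernel A (FA f) (FA p)"
    unfolding F by (rule A.cokernel_comp_epic[OF M(5) map_Hom[OF m(2)] E(3) map_Hom[OF e(1)]])
  ultimately show ?thesis using that k(2) p(2) unfolding B.hom_iff by blast
qed

lemma map_partial_sum:
  assumes "X \<in> Obj B" "Y \<in> Obj B" "\<And>k. k < n \<Longrightarrow> g k \<in> Hom B X Y"
  shows "FA (partial_sum B X Y g n) = partial_sum A (FO X) (FO Y) (\<lambda>k. FA (g k)) n"
  using assms(3)
proof (induction n)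
  case 0
  then show ?case using map_zero assms by simp
next
  case (Suc n)
  have "partial_sum B X Y g n \<in> Hom B X Y" "g n \<in> Hom B X Y"
    using B.partial_sum_in_hom[of X Y n g n] Suc.prems assms by auto
  then show ?case using Suc map_add by simp
qed

lemma map_biproduct:
  assumes "B.is_biproduct n Y X i p"
  shows "A.is_biproduct n (\<lambda>k. FO (Y k)) (FO X) (\<lambda>k. FA (i k)) (\<lambda>k. FA (p k))"
proof -
  note D = B.biproductD[OF assms]
  have "Comp A (FA (p k)) (FA (i l)) = (if l = k then Ide A (FO (Y k)) else Zero A (FO (Y l)) (FO (Y k)))"
    if "k < n" "l < n" for k l
    using map_comp[OF D(3)[OF that(2)] D(4)[OF that(1)]] D(5)[OF that] map_ide map_zero D(2) that by auto
  moreover have "partial_sum A (FO X) (FO X) (\<lambda>k. Comp A (FA (i k)) (FA (p k))) n = Ide A (FO X)"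
  proof -
    have "partial_sum A (FO X) (FO X) (\<lambda>k. Comp A (FA (i k)) (FA (p k))) n
        = partial_sum A (FO X) (FO X) (\<lambda>k. FA (Comp B (i k) (p k))) n"
      by (rule A.partial_sum_cong) (use map_comp[OF D(4,3)] in auto)
    also have "\<dots> = FA (partial_sum B X X (\<lambda>k. Comp B (i k) (p k)) n)"
      by (rule map_partial_sum[symmetric]) (use D(1) B.comp_in_Hom[OF D(4,3)] in auto)
    finally show ?thesis using D(1,6) map_ide by simp
  qed
  ultimately show ?thesis
    unfolding A.is_biproduct_def using D(1-4) map_Obj map_Hom by simp
qed

lemma ess_imageI: "Y \<in> Obj B \<Longrightarrow> isomorphic A (FO Y) X \<Longrightarrow> X \<in> ess_image B A FO"
  unfolding ess_image_def by (auto elim: A.isomorphicE dest: A.Obj_of_hom)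

lemma ess_imageE:
  assumes "X \<in> ess_image B A FO"
  obtains Y a b where "Y \<in> Obj B" "a \<in> Hom A (FO Y) X" "b \<in> Hom A X (FO Y)"
    "Comp A b a = Ide A (FO Y)" "Comp A a b = Ide A X"
  using assms A.isomorphicE unfolding ess_image_def mem_Collect_eq by metis

lemma ess_image_direct_sum:
  assumes Y: "\<And>k. k < n \<Longrightarrow> Y k \<in> ess_image B A FO" and d: "is_direct_sum A n Y X i"
  shows "X \<in> ess_image B A FO"
proof -
  have "\<exists>W a b. W \<in> Obj B \<and> a \<in> Hom A (FO W) (Y k) \<and> b \<in> Hom A (Y k) (FO W) \<and>
      Comp A a b = Ide A (Y k) \<and> Comp A b a = Ide A (FO W)" if "k < n" for k
    using Y[OF that] ess_imageE by metis
  then obtain W a b where W: "\<And>k. k < n \<Longrightarrow> W k \<in> Obj B"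
      "\<And>k. k < n \<Longrightarrow> a k \<in> Hom A (FO (W k)) (Y k)" "\<And>k. k < n \<Longrightarrow> b k \<in> Hom A (Y k) (FO (W k))"
      "\<And>k. k < n \<Longrightarrow> Comp A (a k) (b k) = Ide A (Y k)" "\<And>k. k < n \<Longrightarrow> Comp A (b k) (a k) = Ide A (FO (W k))"
    by metis
  obtain V j where V: "is_direct_sum B n W V j" using B.has_direct_sums[of n W] W(1) by blast
  obtain p where "B.is_biproduct n W V j p" using B.direct_sum_biproduct[OF V] .
  then have "is_direct_sum A n (\<lambda>k. FO (W k)) (FO V) (\<lambda>k. FA (j k))"
    by (rule A.biproduct_direct_sum[OF map_biproduct])
  moreover have "is_direct_sum A n (\<lambda>k. FO (W k)) X (\<lambda>k. Comp A (i k) (a k))"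
    by (rule A.direct_sum_transport[OF d, of _ "\<lambda>k. FO (W k)"]) (use W in auto)
  ultimately have "isomorphic A (FO V) X" by (rule A.direct_sum_unique)
  then show ?thesis using ess_imageI B.direct_sumD(1)[OF V] by blast
qed

text \<open>A morphism in the essential image is, up to isomorphisms of its ends, the image of a morphism \<open>g\<close> by
  fullness; the kernel and cokernel then come from those of \<open>g\<close>.\<close>

lemma ess_image_kernel_cokernel:
  assumes X: "X \<in> ess_image B A FO" and Y: "Y \<in> ess_image B A FO" and f: "f \<in> Hom A X Y"
  shows "is_kernel A f k \<Longrightarrow> Dom A k \<in> ess_image B A FO"
    and "is_cokernel A f q \<Longrightarrow> Cod A q \<in> ess_image B A FO"
proof -
  obtain V a a' where a: "V \<in> Obj B" "a \<in> Hom A (FO V) X" "a' \<in> Hom A X (FO V)"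
      "Comp A a' a = Ide A (FO V)" "Comp A a a' = Ide A X"
    using ess_imageE[OF X] .
  obtain W b b' where b: "W \<in> Obj B" "b \<in> Hom A (FO W) Y" "b' \<in> Hom A Y (FO W)"
      "Comp A b' b = Ide A (FO W)" "Comp A b b' = Ide A Y"
    using ess_imageE[OF Y] .
  have iso: "iso_arr A a" "iso_arr A b'"
    using A.iso_arrI[OF a(2-5)] A.iso_arrI[OF b(3,2,5,4)] by auto
  have b'f: "Comp A b' f \<in> Hom A X (FO W)" and fa: "Comp A f a \<in> Hom A (FO V) Y"
    using A.comp_in_Hom a b f by blast+
  have "Comp A (Comp A b' f) a \<in> Hom A (FO V) (FO W)" using A.comp_in_Hom a b'f by blast
  then obtain g where g: "g \<in> Hom B V W" "FA g = Comp A (Comp A b' f) a"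
    using obtain_preimage a(1) b(1) by blast
  have g': "FA g = Comp A b' (Comp A f a)" using g(2) a(2) b(3) f by (simp add: A.hom_iff)
  obtain \<kappa> \<rho> where \<kappa>: "\<kappa> \<in> Arr B" "is_kernel A (FA g) (FA \<kappa>)" "\<rho> \<in> Arr B" "is_cokernel A (FA g) (FA \<rho>)"
    using obtain_kernel_cokernel_in_image[OF g(1)] .
  have ends: "Dom A (FA \<kappa>) = FO (Dom B \<kappa>)" "Cod A (FA \<rho>) = FO (Cod B \<rho>)"
    using map_Hom B.hom_self \<kappa>(1,3) A.hom_iff by metis+
  show "Dom A k \<in> ess_image B A FO" if k: "is_kernel A f k"
  proof -
    have "is_kernel A (Comp A b' f) k"
      by (rule A.kernel_comp_monic[OF k f A.iso_arr_monic[OF iso(2)] b(3)])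
    then have "is_kernel A (FA g) (Comp A a' k)"
      unfolding g(2) by (rule A.kernel_precomp_iso[OF _ b'f a(2-5)])
    then have "isomorphic A (Dom A (FA \<kappa>)) (Dom A (Comp A a' k))" by (rule A.kernel_unique[OF \<kappa>(2)])
    moreover have "Dom A (Comp A a' k) = Dom A k" 
      using A.kernelD(1)[OF k f] a(3) by (simp add: A.hom_iff)
    ultimately show ?thesis using ess_imageI[of "Dom B \<kappa>"] \<kappa>(1) ends by simp
  qed
  show "Cod A q \<in> ess_image B A FO" if q: "is_cokernel A f q"
  proof -
    have "is_cokernel A (Comp A f a) q"
      by (rule A.cokernel_comp_epic[OF q f A.iso_arr_epic[OF iso(1)] a(2)])
    then have "is_cokernel A (FA g) (Comp A q b)"
      unfolding g' by (rule A.cokernel_postcomp_iso[OF _ fa b(3,2,5,4)])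
    then have "isomorphic A (Cod A (FA \<rho>)) (Cod A (Comp A q b))" by (rule A.cokernel_unique[OF \<kappa>(4)])
    moreover have "Cod A (Comp A q b) = Cod A q" 
      using A.cokernelD(1)[OF q f] b(2) by (simp add: A.hom_iff)
    ultimately show ?thesis using ess_imageI[of "Cod B \<rho>"] \<kappa>(3) ends by simp
  qed
qed

theorem closed_ess_image: "closed_full_subcategory A (ess_image B A FO)"
proof (intro closed_full_subcategory.intro closed_full_subcategory_axioms.intro)
  show "abelian_category A" by unfold_locales
  show "replete A (ess_image B A FO)"
    unfolding replete_def using A.isomorphic_trans ess_imageI by (auto simp: ess_image_def)
  show "closed_direct_sums A (ess_image B A FO)"
    unfolding closed_direct_sums_def using ess_image_direct_sum by blast
  show "closed_kernels A (ess_image B A FO)" "closed_cokernels A (ess_image B A FO)"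
    unfolding closed_kernels_def closed_cokernels_def using ess_image_kernel_cokernel by blast+
qed

end

theorem proposition7p2:
  fixes A :: "('o, 'm) precat"
  assumes "abelian_category A"
  shows
    "(\<forall>(C :: 'o set) (m :: nat).
        replete A C \<and> closed_direct_sums A C \<and> closed_kernels A C \<and> closed_cokernels A C \<longrightarrow>
        replete A (filtered A C m) \<and> closed_direct_sums A (filtered A C m) \<and>
        closed_kernels A (filtered A C m) \<and> closed_cokernels A (filtered A C m))
     \<and>
     (\<forall>(B :: ('p, 'q) precat) FO FA.
        abelian_category B \<and> exact_functor B A FO FA \<and> fully_faithful B A FO FA \<longrightarrow>
        (let C = ess_image B A FO in
          replete A C \<and> closed_direct_sums A C \<and> closed_kernels A C \<and> closed_cokernels A C \<and>
          (\<forall>m :: nat.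
            abelian_category (full_subcat A (filtered A C m)) \<and>
            exact_functor (full_subcat A (filtered A C m)) A (\<lambda>X. X) (\<lambda>f. f) \<and>
            fully_faithful (full_subcat A (filtered A C m)) A (\<lambda>X. X) (\<lambda>f. f))))"
proof (rule conjI; intro allI impI; elim conjE)
  fix C :: "'o set" and m :: nat
  assume "replete A C" "closed_direct_sums A C" "closed_kernels A C" "closed_cokernels A C"
  then interpret C: closed_full_subcategory A C
    using assms by (intro closed_full_subcategory.intro closed_full_subcategory_axioms.intro)
  interpret E: closed_full_subcategory A "filtered A C m" by (rule C.closed_full_subcategory_filtered)
  show "replete A (filtered A C m) \<and> closed_direct_sums A (filtered A C m) \<and>
      closed_kernels A (filtered A C m) \<and> closed_cokernels A (filtered A C m)"
    using E.repl E.sums E.kers E.cokers by blast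
next
  fix B :: "('p, 'q) precat" and FO FA
  assume "abelian_category B" "exact_functor B A FO FA" "fully_faithful B A FO FA"
  then interpret F: fully_faithful_exact_functor B A FO FA
    using assms by (intro fully_faithful_exact_functor.intro fully_faithful_exact_functor_axioms.intro)
  define C where "C = ess_image B A FO"
  interpret C: closed_full_subcategory A C unfolding C_def by (rule F.closed_ess_image)
  have "abelian_category (full_subcat A (filtered A C m)) \<and>
      exact_functor (full_subcat A (filtered A C m)) A (\<lambda>X. X) (\<lambda>f. f) \<and>
      fully_faithful (full_subcat A (filtered A C m)) A (\<lambda>X. X) (\<lambda>f. f)" for m
  proof -
    interpret E: closed_full_subcategory A "filtered A C m" by (rule C.closed_full_subcategory_filtered)
    show ?thesis using E.abelian_full_subcat E.exact_inclusion E.fully_faithful_inclusion by blast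
  qed
  then show "let C = ess_image B A FO in
          replete A C \<and> closed_direct_sums A C \<and> closed_kernels A C \<and> closed_cokernels A C \<and>
          (\<forall>m :: nat.
            abelian_category (full_subcat A (filtered A C m)) \<and>
            exact_functor (full_subcat A (filtered A C m)) A (\<lambda>X. X) (\<lambda>f. f) \<and>
            fully_faithful (full_subcat A (filtered A C m)) A (\<lambda>X. X) (\<lambda>f. f))"
    unfolding Let_def C_def[symmetric] using C.repl C.sums C.kers C.cokers by blast
qed

end
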